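(* Let $n\ge 3$, $s\ge 1$, and $H=(-\Delta)^{\frac s2}$ on $L^2(\mathbb{R}^n)$. There exist a fixed constant $\sigma>0$ and a large but fixed number $T_0>0$ such that the following holds. Let $u_0\in L^2(\mathbb{R}^n)$ and let $u(x,t)$ be the solution of the Cauchy problem $i\partial_tu=Hu$, $u(x,0)=u_0(x)$. If for some $r>0$ and some $t_2>t_1\ge 0$ with $t_2-t_1>r^sT_0$, $$\operatorname{supp}u(\cdot,t_1)\subset B(0,r)\quad\text{and}\quad\operatorname{supp}u(\cdot,t_2)\subset B\left(0,\sigma(t_2-t_1)/r^{s-1}\right),$$ then $u\equiv 0$.
   Context: $(-\Delta)^{s/2}$ is the self-adjoint operator on $L^2(\mathbb{R}^n)$ with domain the Sobolev space $H^s(\mathbb{R}^n)$ given by the Fourier multiplier $|\xi|^s$; the solution is $u(\cdot,t)=e^{-itH}u_0$. $B(0,\rho)$ is the ball of radius $\rho$ centered at the origin. *)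

theory Defs
  imports "HOL-Analysis.Analysis"
begin

text \<open>Elements of \<open>L\<^sup>2\<close> are represented by Borel functions; functions that agree
  almost everywhere represent the same element. Operators on \<open>L\<^sup>2\<close>, possibly unbounded, are
  represented by their graphs, which are closed under almost-everywhere equality on both sides.\<close>

definition L2 :: "('a::euclidean_space \<Rightarrow> complex) set" where
  "L2 = {f \<in> borel_measurable lborel. integrable lborel (\<lambda>x. (cmod (f x))\<^sup>2)}"

type_synonym 'a L2_operator = "('a \<Rightarrow> complex) \<Rightarrow> ('a \<Rightarrow> complex) \<Rightarrow> bool"

definition ess_supp :: "('a::euclidean_space \<Rightarrow> complex) \<Rightarrow> 'a set" where
  "ess_supp f = - \<Union>{V. open V \<and> (AE x in lborel. x \<in> V \<longrightarrow> f x = 0)}"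

definition fourier_integral :: "('a::euclidean_space \<Rightarrow> complex) \<Rightarrow> 'a \<Rightarrow> complex" where
  "fourier_integral f \<xi> =
     of_real ((2 * pi) powr (- real DIM('a) / 2)) *
     (LINT x|lborel. exp (- \<i> * of_real (x \<bullet> \<xi>)) * f x)"

text \<open>The Plancherel transform of \<open>f\<close> is the \<open>L\<^sup>2\<close>-limit of the Fourier integrals of the
  truncations of \<open>f\<close> to balls, which are integrable. The nonnegative integral is used so that
  an infinite distance is not read as \<open>0\<close>.\<close>

definition has_fourier_L2 :: "('a::euclidean_space \<Rightarrow> complex) \<Rightarrow> ('a \<Rightarrow> complex) \<Rightarrow> bool" where
  "has_fourier_L2 f F \<longleftrightarrow> f \<in> L2 \<and> F \<in> L2 \<and>
     ((\<lambda>R. \<integral>\<^sup>+ \<xi>. ennreal ((cmod (F \<xi> - fourier_integral (\<lambda>x. indicator (ball 0 R) x * f x) \<xi>))\<^sup>2)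
        \<partial>lborel) \<longlongrightarrow> 0) at_top"

definition sobolev :: "real \<Rightarrow> ('a::euclidean_space \<Rightarrow> complex) set" where
  "sobolev s = {f \<in> L2. \<exists>F. has_fourier_L2 f F \<and>
     (\<lambda>\<xi>. of_real ((1 + (norm \<xi>)\<^sup>2) powr (s / 2)) * F \<xi>) \<in> L2}"

text \<open>Taken with its maximal domain: \<open>f\<close> is in the domain iff \<open>m\<close> times its transform
  is in \<open>L\<^sup>2\<close>.\<close>

definition fourier_multiplier :: "('a::euclidean_space \<Rightarrow> complex) \<Rightarrow> 'a L2_operator" where
  "fourier_multiplier m f g \<longleftrightarrow>
     (\<exists>F G. has_fourier_L2 f F \<and> has_fourier_L2 g G \<and> (AE \<xi> in lborel. G \<xi> = m \<xi> * F \<xi>))"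

text \<open>The operator \<open>(-\<Delta>)\<^sup>s\<^sup>/\<^sup>2\<close> with domain \<open>H\<^sup>s\<close>.\<close>

definition frac_laplacian :: "real \<Rightarrow> 'a::euclidean_space L2_operator" where
  "frac_laplacian s f g \<longleftrightarrow>
     f \<in> sobolev s \<and> fourier_multiplier (\<lambda>\<xi>. of_real (norm \<xi> powr s)) f g"

text \<open>Functional calculus for self-adjoint operators \<open>H\<close> that the Fourier transform
  diagonalizes: if \<open>H\<close> is unitarily equivalent, via the Fourier transform, to multiplication
  by a real function \<open>m\<close>, then \<open>\<phi>(H)\<close> corresponds to multiplication by \<open>\<phi> \<circ> m\<close>.
  The function \<open>m\<close> is determined almost everywhere by \<open>H\<close>.\<close>

definition functional_calculus ::
    "(real \<Rightarrow> complex) \<Rightarrow> 'a::euclidean_space L2_operator \<Rightarrow> 'a L2_operator" where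
  "functional_calculus \<phi> H f g \<longleftrightarrow>
     (\<exists>m. m \<in> borel_measurable lborel \<and>
        H = fourier_multiplier (\<lambda>\<xi>. of_real (m \<xi>)) \<and>
        fourier_multiplier (\<lambda>\<xi>. \<phi> (m \<xi>)) f g)"

definition propagator :: "'a::euclidean_space L2_operator \<Rightarrow> real \<Rightarrow> 'a L2_operator" where
  "propagator H t = functional_calculus (\<lambda>l. exp (- \<i> * of_real t * of_real l)) H"

text \<open>The solution \<open>u(\<cdot>,t) = e\<^sup>-\<^sup>i\<^sup>t\<^sup>H u\<^sub>0\<close> of \<open>i \<partial>\<^sub>t u = H u\<close>, \<open>u(\<cdot>,0) = u\<^sub>0\<close>; for
  general \<open>u\<^sub>0 \<in> L\<^sup>2\<close> it need not be differentiable in time.\<close>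

definition cauchy_solution ::
    "'a::euclidean_space L2_operator \<Rightarrow> ('a \<Rightarrow> complex) \<Rightarrow> (real \<Rightarrow> 'a \<Rightarrow> complex) \<Rightarrow> bool" where
  "cauchy_solution H u0 u \<longleftrightarrow> (\<forall>t. propagator H t u0 (u t))"

end

theory Submission
  imports
    Defs
    "HOL-Probability.Characteristic_Functions"
    "HOL-Complex_Analysis.Conformal_Mappings"
    "HOL-Real_Asymp.Real_Asymp"
begin

text \<open>
  A solution whose supports at two distinct times \<open>t1 < t2\<close> are bounded vanishes identically; the theorem
  follows with \<open>\<sigma> = T\<^sub>0 = 1\<close>. The reason is analyticity in frequency. The transforms of \<open>f = u(t1)\<close> and
  \<open>g = u(t2)\<close> extend to entire functions of exponential type, and on real frequencies
  \<open>g^(\<xi>) = exp (- \<i> t |\<xi>|\<^sup>s) f^(\<xi>)\<close> with \<open>t = t2 - t1\<close>. Restrict both to a complex line \<open>z \<omega>\<close> through the origin and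
  call the restrictions \<open>F\<close> and \<open>G\<close>. If \<open>s > 1\<close>, continuing the relation into the right half-plane
  shows that \<open>F\<close> decays like \<open>exp (- t \<rho>\<^sup>s)\<close>, up to an exponential factor, along the ray of argument \<open>\<pi> / (2 s)\<close>;
  by Phragmen-Lindelof an entire function of exponential type that is bounded on the real axis and decays so fast on
  a ray in the open upper half-plane is zero (\<open>superlinear_phase_forces_zero\<close>). If \<open>s = 1\<close>, the continuations from the
  positive and from the negative half-line contradict each other unless \<open>F = 0\<close>
  (\<open>linear_phase_forces_zero\<close>).

  The remaining work is \<open>L\<^sup>2\<close> Fourier analysis, which connects the operators, given by their graphs, with
  pointwise multiplication. Three facts are needed: the symbol of the operator is determined almost everywhere
  (\<open>frac_laplacian_symbol_unique\<close>), the Plancherel transform of a function of bounded support is its Fourier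
  integral (\<open>fourier_L2_eq_fourier_integral\<close>), and the Plancherel transform is injective
  (\<open>fourier_L2_injective\<close>). All of them rest on one formula, Parseval's identity with a
  Gaussian cut-off (\<open>gauss_regularized_parseval\<close>), and its limit.
\<close>

section \<open>Phragmen-Lindelof principles\<close>

text \<open>A Phragmen-Lindelof barrier \<open>exp (- c exp (\<kappa> X))\<close> beats every growth \<open>exp (B exp (\<mu> X))\<close>
  of smaller inner rate; on the far vertical edges of a rectangle this leaves room below any level \<open>M\<close>.\<close>

lemma doubly_exponential_gap_eventually_small:
  fixes A B c \<mu> \<kappa> M :: real
  assumes "0 < c" "\<mu> < \<kappa>" "0 < \<kappa>" "0 < M"
  shows "\<forall>\<^sub>F X in at_top. A * exp (B * exp (\<mu> * X) - c * exp (\<kappa> * X)) \<le> M"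
proof -
  have "((\<lambda>X. exp (-((\<kappa> - \<mu>) * X))) \<longlongrightarrow> 0) at_top"
    using assms(2) by real_asymp
  then have "((\<lambda>X. c - B * exp (-((\<kappa> - \<mu>) * X))) \<longlongrightarrow> c - B * 0) at_top"
    by (intro tendsto_intros)
  moreover have "filterlim (\<lambda>X. exp (\<kappa> * X)) at_top at_top"
    using assms(3) by real_asymp
  ultimately have "filterlim (\<lambda>X. (c - B * exp (-((\<kappa> - \<mu>) * X))) * exp (\<kappa> * X)) at_top at_top"
    using assms(1) by (intro filterlim_tendsto_pos_mult_at_top) auto
  then have "filterlim (\<lambda>X. - ((c - B * exp (-((\<kappa> - \<mu>) * X))) * exp (\<kappa> * X))) at_bot at_top"
    by (simp add: filterlim_uminus_at_top)
  then have "((\<lambda>X. exp (- ((c - B * exp (-((\<kappa> - \<mu>) * X))) * exp (\<kappa> * X)))) \<longlongrightarrow> 0) at_top"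
    by (rule filterlim_compose[OF exp_at_bot])
  then have "((\<lambda>X. A * exp (- ((c - B * exp (-((\<kappa> - \<mu>) * X))) * exp (\<kappa> * X)))) \<longlongrightarrow> A * 0) at_top"
    by (intro tendsto_intros)
  then have "\<forall>\<^sub>F X in at_top. A * exp (- ((c - B * exp (-((\<kappa> - \<mu>) * X))) * exp (\<kappa> * X))) < M"
    using assms(4) by (intro order_tendstoD(2)[where y="A*0"]) auto
  moreover have "- ((c - B * exp (-((\<kappa> - \<mu>) * X))) * exp (\<kappa> * X)) = B * exp (\<mu> * X) - c * exp (\<kappa> * X)" for X
    by (simp add: algebra_simps flip: exp_add)
  ultimately show ?thesis
    by (auto elim: eventually_mono)
qed

text \<open>The Phragmen-Lindelof principle in logarithmic coordinates, where a sector becomes a strip. Damping by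
  \<open>exp (- \<epsilon> cosh (\<kappa> w))\<close> controls both ends of the strip at once, that is, the vertex of the sector as well
  as infinity, and \<open>\<kappa> a < \<pi> / 2\<close> keeps \<open>Re (cosh (\<kappa> w))\<close> positive. The maximum modulus principle on a long rectangle
  bounds the damped function by \<open>M\<close>, and then \<open>\<epsilon>\<close> tends to \<open>0\<close>.\<close>

lemma phragmen_lindelof_strip:
  fixes K :: "complex \<Rightarrow> complex" and a \<mu> \<kappa> A B M :: real
  assumes hol: "K holomorphic_on UNIV"
    and "0 < a" "\<mu> < \<kappa>" "0 < \<kappa>" "\<kappa> * a < pi / 2" "0 < M"
    and bound: "\<And>w. \<bar>Im w\<bar> \<le> a \<Longrightarrow> norm (K w) \<le> A * exp (B * exp (\<mu> * \<bar>Re w\<bar>))"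
    and edge: "\<And>w. \<bar>Im w\<bar> = a \<Longrightarrow> norm (K w) \<le> M"
    and w0: "\<bar>Im w0\<bar> \<le> a"
  shows "norm (K w0) \<le> M"
proof -
  \<comment> \<open>\<open>C w\<close> is \<open>cosh (\<kappa> w)\<close>, written with exponentials to compute its real part.\<close>
  define C where "C w = (exp (\<kappa> * w) + exp (- (\<kappa> * w))) / 2" for w :: complex
  have ReC: "Re (C w) = (exp (\<kappa> * Re w) + exp (- (\<kappa> * Re w))) / 2 * cos (\<kappa> * Im w)" for w
    by (simp add: C_def Re_exp distrib_right)
  define \<delta> where "\<delta> = cos (\<kappa> * a)"
  have \<delta>: "0 < \<delta>"
    unfolding \<delta>_def using assms by (intro cos_gt_zero) auto
  have cosge: "\<delta> \<le> cos (\<kappa> * Im w)" if "\<bar>Im w\<bar> \<le> a" for w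
  proof -
    have "\<kappa> * a \<le> pi" using assms pi_gt_zero by linarith
    then have "cos (\<kappa> * a) \<le> cos \<bar>\<kappa> * Im w\<bar>"
      using assms that by (intro cos_monotone_0_pi_le) (auto simp: abs_mult)
    then show ?thesis by (simp add: \<delta>_def)
  qed
  have ReC_ge: "\<delta> / 2 * exp (\<kappa> * \<bar>Re w\<bar>) \<le> Re (C w)" if "\<bar>Im w\<bar> \<le> a" for w
  proof -
    have "exp (\<kappa> * \<bar>Re w\<bar>) \<le> exp (\<kappa> * Re w) + exp (- (\<kappa> * Re w))"
      by (cases "Re w \<ge> 0") auto
    then have "\<delta> * exp (\<kappa> * \<bar>Re w\<bar>) \<le> cos (\<kappa> * Im w) * (exp (\<kappa> * Re w) + exp (- (\<kappa> * Re w)))"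
      using cosge[OF that] \<delta> by (intro mult_mono) auto
    then show ?thesis by (simp add: ReC algebra_simps)
  qed
  have damped: "norm (K w0) * exp (- (\<epsilon> * Re (C w0))) \<le> M" if "0 < \<epsilon>" for \<epsilon>
  proof -
    define g where "g w = K w * exp (- (\<epsilon> * C w))" for w
    have norm_g: "norm (g w) = norm (K w) * exp (- (\<epsilon> * Re (C w)))" for w
      by (simp add: g_def norm_mult)
    have "\<forall>\<^sub>F X in at_top. A * exp (B * exp (\<mu> * X) - (\<epsilon> * \<delta> / 2) * exp (\<kappa> * X)) \<le> M"
      using assms \<delta> \<open>0 < \<epsilon>\<close> by (intro doubly_exponential_gap_eventually_small) auto
    moreover have "\<forall>\<^sub>F X in at_top. \<bar>Re w0\<bar> \<le> X" by (rule eventually_ge_at_top)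
    ultimately obtain X where X: "A * exp (B * exp (\<mu> * X) - (\<epsilon> * \<delta> / 2) * exp (\<kappa> * X)) \<le> M"
        "\<bar>Re w0\<bar> \<le> X"
      using eventually_happens'[OF trivial_limit_at_top_linorder eventually_conj] by blast
    define S where "S = cbox (Complex (-X) (-a)) (Complex X a)"
    have S: "w \<in> S \<longleftrightarrow> \<bar>Re w\<bar> \<le> X \<and> \<bar>Im w\<bar> \<le> a" for w
      by (auto simp: S_def in_cbox_complex_iff)
    have holg: "g holomorphic_on T" for T
      unfolding g_def C_def by (intro holomorphic_intros holomorphic_on_subset[OF hol]) auto
    have "norm (g w0) \<le> M"
    proof (rule maximum_modulus_frontier[where f=g and S=S])
      show "g holomorphic_on interior S" "continuous_on (closure S) g"
        using holg by (auto intro: holomorphic_on_imp_continuous_on)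
      show "bounded S" "w0 \<in> S" using w0 X(2) by (auto simp: S) (simp add: S_def)
      fix w assume "w \<in> frontier S"
      then have wS: "\<bar>Re w\<bar> \<le> X" "\<bar>Im w\<bar> \<le> a" and "\<bar>Re w\<bar> = X \<or> \<bar>Im w\<bar> = a"
        by (auto simp: S_def frontier_cbox in_cbox_complex_iff in_box_complex_iff)
      then consider "\<bar>Re w\<bar> = X" | "\<bar>Im w\<bar> = a" by blast
      then show "norm (g w) \<le> M"
      proof cases
        case 1
        have "norm (g w) \<le> A * exp (B * exp (\<mu> * X)) * exp (- (\<epsilon> * (\<delta> / 2 * exp (\<kappa> * X))))"
          unfolding norm_g using bound[OF wS(2)] ReC_ge[OF wS(2)] \<open>0 < \<epsilon>\<close> 1
          by (intro mult_mono) (auto intro: order_trans[OF norm_ge_zero])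
        also have "\<dots> = A * exp (B * exp (\<mu> * X) - (\<epsilon> * \<delta> / 2) * exp (\<kappa> * X))"
          by (simp only: mult.assoc exp_add[symmetric]) (simp add: algebra_simps)
        finally show ?thesis using X(1) by simp
      next
        case 2
        have "0 \<le> Re (C w)"
          using ReC_ge[OF wS(2)] \<delta> by (smt (verit) divide_pos_pos exp_gt_zero mult_pos_pos)
        then have "norm (g w) \<le> M * 1"
          unfolding norm_g using edge[OF 2] \<open>0 < \<epsilon>\<close> \<open>0 < M\<close> by (intro mult_mono) auto
        then show ?thesis by simp
      qed
    qed
    then show ?thesis by (simp add: norm_g)
  qed
  have "((\<lambda>\<epsilon>. norm (K w0) * exp (- (\<epsilon> * Re (C w0)))) \<longlongrightarrow> norm (K w0) * exp (- (0 * Re (C w0)))) (at_right 0)"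
    by (intro tendsto_intros)
  then have "norm (K w0) * exp (- (0 * Re (C w0))) \<le> M"
    by (rule tendsto_upperbound) (auto intro!: damped simp: eventually_at_right_less eventually_at_right_field intro: exI[of _ 1])
  then show ?thesis by simp
qed

text \<open>The substitution \<open>z = exp (w + \<i> \<gamma>)\<close>, with \<open>\<gamma>\<close> the bisecting direction, maps a symmetric strip onto the
  sector. Polar coordinates describe the sector without a choice of branch of the argument.\<close>

lemma phragmen_lindelof_sector:
  fixes k :: "complex \<Rightarrow> complex"
  assumes hol: "k holomorphic_on UNIV" and ab: "\<alpha> < \<beta>" and \<mu>: "0 \<le> \<mu>" "\<mu> * (\<beta> - \<alpha>) < pi" and "0 < M" "0 \<le> B"
    and bound: "\<And>\<rho> \<phi>. 0 < \<rho> \<Longrightarrow> \<alpha> \<le> \<phi> \<Longrightarrow> \<phi> \<le> \<beta> \<Longrightarrow> norm (k (rcis \<rho> \<phi>)) \<le> A * exp (B * \<rho> powr \<mu>)"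
    and edge: "\<And>\<rho>. 0 < \<rho> \<Longrightarrow> norm (k (rcis \<rho> \<alpha>)) \<le> M" "\<And>\<rho>. 0 < \<rho> \<Longrightarrow> norm (k (rcis \<rho> \<beta>)) \<le> M"
    and "0 < \<rho>" "\<alpha> \<le> \<phi>" "\<phi> \<le> \<beta>"
  shows "norm (k (rcis \<rho> \<phi>)) \<le> M"
proof -
  define \<gamma> a where "\<gamma> = (\<alpha> + \<beta>) / 2" and "a = (\<beta> - \<alpha>) / 2"
  define K where "K w = k (exp (w + \<i> * \<gamma>))" for w
  have K: "K w = k (rcis (exp (Re w)) (Im w + \<gamma>))" for w
    using exp_eq_polar[of "w + \<i> * \<gamma>"] by (simp add: K_def rcis_def)
  have "A \<ge> 0"
    using bound[of \<rho> \<phi>] assms by (smt (verit) exp_gt_zero norm_ge_zero zero_le_mult_iff)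
  have "\<mu> * a < pi / 2" "0 < a" using \<mu> ab by (auto simp: a_def field_simps)
  then have "\<mu> < pi / 2 / a" by (simp add: field_simps)
  then obtain \<kappa> where \<kappa>: "\<mu> < \<kappa>" "\<kappa> < pi / 2 / a" using dense by blast
  have "norm (K (Complex (ln \<rho>) (\<phi> - \<gamma>))) \<le> M"
  proof (rule phragmen_lindelof_strip[where K=K and a=a and \<mu>=\<mu> and \<kappa>=\<kappa> and A=A and B=B])
    show "K holomorphic_on UNIV"
      unfolding K_def by (intro holomorphic_intros holomorphic_on_compose_gen[OF _ hol, unfolded o_def]) auto
    show "0 < a" "\<mu> < \<kappa>" "0 < \<kappa>" "\<kappa> * a < pi / 2" "0 < M"
      using \<kappa> \<mu> \<open>0 < a\<close> \<open>0 < M\<close> by (auto simp: field_simps)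
    show "norm (K w) \<le> A * exp (B * exp (\<mu> * \<bar>Re w\<bar>))" if "\<bar>Im w\<bar> \<le> a" for w
    proof -
      have "norm (K w) \<le> A * exp (B * exp (Re w) powr \<mu>)"
        unfolding K using that by (intro bound) (auto simp: a_def \<gamma>_def field_simps abs_le_iff)
      also have "exp (Re w) powr \<mu> = exp (\<mu> * Re w)" by (simp add: powr_def)
      also have "A * exp (B * exp (\<mu> * Re w)) \<le> A * exp (B * exp (\<mu> * \<bar>Re w\<bar>))"
        using \<open>A \<ge> 0\<close> \<mu> \<open>0 \<le> B\<close> by (intro mult_left_mono) (auto intro!: mult_left_mono)
      finally show ?thesis .
    qed
    show "norm (K w) \<le> M" if "\<bar>Im w\<bar> = a" for w
    proof -
      have "Im w + \<gamma> = \<alpha> \<or> Im w + \<gamma> = \<beta>"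
        using that by (auto simp: a_def \<gamma>_def field_simps abs_if split: if_splits)
      then show ?thesis unfolding K using edge by auto
    qed
    show "\<bar>Im (Complex (ln \<rho>) (\<phi> - \<gamma>))\<bar> \<le> a"
      using assms by (auto simp: a_def \<gamma>_def field_simps abs_le_iff)
  qed
  then show ?thesis using \<open>0 < \<rho>\<close> by (simp add: K)
qed

text \<open>A nonzero bounded holomorphic function on a half-plane cannot decay faster than every exponential along a ray.
  For each \<open>N\<close> the function \<open>k z = h z exp (- \<i> N z)\<close> has modulus at most \<open>M\<close> on the real axis, is bounded on the ray and
  has exponential type. The ray cuts the half-plane into two sectors of opening less than \<open>\<pi>\<close>, so \<open>k\<close> is bounded,
  by some constant that depends on \<open>N\<close>. A second application, now to a bounded function on the whole half-plane,
  improves that constant to the bound \<open>M\<close> from the real axis. Hence \<open>|h z| \<le> M exp (- N Im z)\<close> for all \<open>N\<close>.\<close>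

lemma bounded_halfplane_superexponential_ray_zero:
  fixes h :: "complex \<Rightarrow> complex"
  assumes hol: "h holomorphic_on UNIV"
    and bdd: "\<And>z. 0 \<le> Im z \<Longrightarrow> norm (h z) \<le> M"
    and \<theta>: "0 < \<theta>" "\<theta> < pi"
    and ray: "\<And>N::nat. \<exists>C. \<forall>\<rho>>0. norm (h (rcis \<rho> \<theta>)) \<le> C * exp (- (real N * \<rho>))"
    and z: "0 < Im z"
  shows "h z = 0"
proof -
  define M' where "M' = max M 1"
  have M': "0 < M'" "\<And>z. 0 \<le> Im z \<Longrightarrow> norm (h z) \<le> M'"
    using bdd by (auto simp: M'_def le_max_iff_disj)
  have main: "norm (h z) * exp (real N * Im z) \<le> M'" for N :: nat
  proof -
    define k where "k z = h z * exp (- (\<i> * N * z))" for z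
    have norm_k: "norm (k z) = norm (h z) * exp (real N * Im z)" for z
      by (simp add: k_def norm_mult)
    have holk: "k holomorphic_on UNIV"
      unfolding k_def by (intro holomorphic_intros hol)
    have Im_ge: "0 \<le> Im (rcis \<rho> \<phi>)" if "0 < \<rho>" "0 \<le> \<phi>" "\<phi> \<le> pi" for \<rho> \<phi>
      using that by (simp add: sin_ge_zero)
    have type1: "norm (k (rcis \<rho> \<phi>)) \<le> M' * exp (real N * \<rho> powr 1)" if "0 < \<rho>" "0 \<le> \<phi>" "\<phi> \<le> pi" for \<rho> \<phi>
    proof -
      have "Im (rcis \<rho> \<phi>) \<le> \<rho> * 1" unfolding Im_rcis using that by (intro mult_left_mono) auto
      then show ?thesis
        unfolding norm_k using M' Im_ge[OF that] that
        by (intro mult_mono) (auto intro: mult_left_mono)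
    qed
    obtain C where C: "\<And>\<rho>. \<rho> > 0 \<Longrightarrow> norm (h (rcis \<rho> \<theta>)) \<le> C * exp (- (real N * \<rho>))"
      using ray by blast
    have "norm (h (rcis 1 \<theta>)) \<le> C * exp (- (real N * 1))" by (rule C) simp
    then have "0 \<le> C" by (smt (verit) exp_gt_zero norm_ge_zero zero_le_mult_iff)
    \<comment> \<open>\<open>M2\<close> depends on \<open>N\<close> through \<open>C\<close>; only its finiteness matters for the second application.\<close>
    define M2 where "M2 = max M' C"
    have M2: "0 < M2" "M' \<le> M2" "C \<le> M2" using M' by (auto simp: M2_def)
    have k_ray: "norm (k (rcis \<rho> \<theta>)) \<le> M2" if "0 < \<rho>" for \<rho>
    proof -
      have "Im (rcis \<rho> \<theta>) \<le> \<rho> * 1" unfolding Im_rcis using that by (intro mult_left_mono) auto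
      then have "norm (k (rcis \<rho> \<theta>)) \<le> C * exp (- (real N * \<rho>)) * exp (real N * \<rho>)"
        unfolding norm_k using C[OF that] \<open>0 \<le> C\<close> by (intro mult_mono) (auto intro: mult_left_mono)
      also have "\<dots> = C" by (simp add: exp_minus)
      finally show ?thesis using M2 by simp
    qed
    have k_real: "norm (k (rcis \<rho> 0)) \<le> M'" "norm (k (rcis \<rho> pi)) \<le> M'" if "0 < \<rho>" for \<rho>
      unfolding norm_k using that M' by auto
    have k_real': "norm (k (rcis \<rho> 0)) \<le> M2" "norm (k (rcis \<rho> pi)) \<le> M2" if "0 < \<rho>" for \<rho>
      using k_real[OF that] M2(2) by (auto simp only: intro: order_trans)
    have k_M2: "norm (k (rcis \<rho> \<phi>)) \<le> M2" if "0 < \<rho>" "0 \<le> \<phi>" "\<phi> \<le> pi" for \<rho> \<phi>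
    proof (cases "\<phi> \<le> \<theta>")
      case True
      show ?thesis
        by (rule phragmen_lindelof_sector[OF holk, of 0 \<theta> 1 M2 "real N" M'])
          (use that True M2 \<theta> type1 k_ray k_real' in auto)
    next
      case False
      show ?thesis
        by (rule phragmen_lindelof_sector[OF holk, of \<theta> pi 1 M2 "real N" M'])
          (use that False M2 \<theta> type1 k_ray k_real' in auto)
    qed
    have "norm (k (rcis (norm z) (Arg z))) \<le> M'"
    proof (rule phragmen_lindelof_sector[OF holk, of 0 pi 0 M' 0 M2])
      show "0 < norm z" "0 \<le> Arg z" "Arg z \<le> pi"
        using z Arg_bounded[of z] by (auto simp: Arg_less_0 less_le)
    qed (use M' k_M2 k_real in auto)
    then show ?thesis by (simp add: rcis_cmod_Arg norm_k)
  qed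
  have "((\<lambda>N. M' * exp (- (real N * Im z))) \<longlongrightarrow> 0) sequentially"
    using z by real_asymp
  moreover have "norm (h z) \<le> M' * exp (- (real N * Im z))" for N
    using main[of N] by (simp add: exp_minus field_simps)
  ultimately have "norm (h z) \<le> 0"
    by (intro tendsto_lowerbound[where f="\<lambda>N. M' * exp (- (real N * Im z))"]) auto
  then show ?thesis by simp
qed

section \<open>Gaussians and the Fourier integral\<close>

lemma
  fixes f :: "'a::euclidean_space \<Rightarrow> real \<Rightarrow> complex"
  assumes "\<And>b. b \<in> Basis \<Longrightarrow> integrable lborel (f b)"
  shows integrable_lborel_prod_Basis: "integrable lborel (\<lambda>x. \<Prod>b\<in>Basis. f b (x \<bullet> b))" (is ?I)
    and integral_lborel_prod_Basis:
      "(LINT x|lborel. (\<Prod>b\<in>Basis. f b (x \<bullet> b))) = (\<Prod>b\<in>Basis. LINT x|lborel. f b x)" (is ?E)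
proof -
  interpret product_sigma_finite "\<lambda>_::'a. lborel :: real measure" ..
  have [measurable]: "f b \<in> borel_measurable borel" if "b \<in> Basis" for b
    using assms[OF that] by (simp add: integrable_iff_bounded)
  have coord: "(\<Prod>b\<in>Basis. f b ((\<Sum>c\<in>Basis. x c *\<^sub>R c) \<bullet> b)) = (\<Prod>b\<in>Basis. f b (x b))" for x
    by (intro prod.cong) auto
  have meas: "(\<lambda>x::'a. \<Prod>b\<in>Basis. f b (x \<bullet> b)) \<in> borel_measurable borel"
    by measurable
  have "integrable (Pi\<^sub>M Basis (\<lambda>_::'a. lborel)) (\<lambda>x. \<Prod>b\<in>Basis. f b (x b))"
    by (intro product_integrable_prod assms) auto
  then show ?I
    by (subst lborel_eq, subst integrable_distr_eq) (use meas in \<open>simp_all add: coord\<close>)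
  have "(LINT x|lborel. (\<Prod>b\<in>Basis. f b (x \<bullet> b)))
      = (LINT x|Pi\<^sub>M Basis (\<lambda>_::'a. lborel). (\<Prod>b\<in>Basis. f b (x b)))"
    by (subst lborel_eq, subst integral_distr) (use meas in \<open>simp_all add: coord\<close>)
  also have "\<dots> = (\<Prod>b\<in>Basis. LINT x|lborel. f b x)"
    by (intro product_integral_prod assms) auto
  finally show ?E .
qed

lemma
  fixes f :: "'a::euclidean_space \<Rightarrow> complex"
  assumes [measurable]: "f \<in> borel_measurable borel" and c: "c \<noteq> 0"
  shows integrable_lborel_affine_iff:
      "integrable lborel (\<lambda>x. f (t + c *\<^sub>R x)) \<longleftrightarrow> integrable lborel f" (is ?I)
    and integral_lborel_affine:
      "(LINT x|lborel. f (t + c *\<^sub>R x)) = (LINT x|lborel. f x) / of_real (\<bar>c\<bar> ^ DIM('a))" (is ?E)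
proof -
  define M :: "'a measure" where "M = distr lborel borel (\<lambda>x. t + c *\<^sub>R x)"
  have M: "f \<in> borel_measurable M" by (simp add: M_def)
  have lb: "lborel = density M (\<lambda>_. ennreal (\<bar>c\<bar> ^ DIM('a)))"
    unfolding M_def using lborel_affine[OF c, of t] by simp
  have "integrable lborel f \<longleftrightarrow> integrable M (\<lambda>x. (\<bar>c\<bar> ^ DIM('a)) *\<^sub>R f x)"
    by (subst lb, rule integrable_density) (use M in auto)
  also have "\<dots> \<longleftrightarrow> integrable M f"
    using c integrable_scaleR_right[of "inverse (\<bar>c\<bar> ^ DIM('a))" M "\<lambda>x. (\<bar>c\<bar> ^ DIM('a)) *\<^sub>R f x"] by auto
  also have "\<dots> \<longleftrightarrow> integrable lborel (\<lambda>x. f (t + c *\<^sub>R x))"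
    unfolding M_def by (rule integrable_distr_eq) auto
  finally show ?I by simp
  have "(LINT x|lborel. f x) = (LINT x|M. (\<bar>c\<bar> ^ DIM('a)) *\<^sub>R f x)"
    by (subst lb, rule integral_density) (use M in auto)
  also have "\<dots> = (\<bar>c\<bar> ^ DIM('a)) *\<^sub>R (LINT x|M. f x)" by simp
  also have "(LINT x|M. f x) = (LINT x|lborel. f (t + c *\<^sub>R x))"
    unfolding M_def by (rule integral_distr) auto
  finally show ?E using c by (simp add: scaleR_conv_of_real)
qed

text \<open>The characteristic function of the standard normal distribution, freed from its normalizing factor.\<close>

lemma
  fixes t :: real
  shows integrable_gaussian_fourier_kernel_real:
      "integrable lborel (\<lambda>x::real. exp (- \<i> * of_real (x * t)) * complex_of_real (exp (- (x\<^sup>2) / 2)))" (is ?I)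
    and integral_gaussian_fourier_kernel_real:
      "(LINT x|lborel. exp (- \<i> * of_real (x * t)) * complex_of_real (exp (- (x\<^sup>2) / 2)))
        = of_real (sqrt (2 * pi) * exp (- (t\<^sup>2) / 2))" (is ?E)
proof -
  have pt: "sqrt (2 * pi) *\<^sub>R (std_normal_density x *\<^sub>R iexp ((- t) * x)) =
      exp (- \<i> * of_real (x * t)) * complex_of_real (exp (- (x\<^sup>2) / 2))" for x
    by (simp add: std_normal_density_def scaleR_conv_of_real mult_ac)
  interpret real_distribution std_normal_distribution by (rule real_dist_normal_dist)
  have "integrable std_normal_distribution (\<lambda>x. iexp ((- t) * x))"
    by (intro integrable_iexp) auto
  then have int: "integrable lborel (\<lambda>x. std_normal_density x *\<^sub>R iexp ((- t) * x))"
    by (subst (asm) integrable_density) auto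
  from integrable_scaleR_right[OF this, of "sqrt (2 * pi)"] show ?I
    by (simp only: pt)
  have "char std_normal_distribution (- t) = (LINT x|lborel. std_normal_density x *\<^sub>R iexp ((- t) * x))"
    unfolding char_def by (rule integral_density) auto
  then have "(LINT x|lborel. std_normal_density x *\<^sub>R iexp ((- t) * x)) = of_real (exp (- (t\<^sup>2) / 2))"
    by (simp add: char_std_normal_distribution)
  then have "sqrt (2 * pi) *\<^sub>R (LINT x|lborel. std_normal_density x *\<^sub>R iexp ((- t) * x))
      = of_real (sqrt (2 * pi) * exp (- (t\<^sup>2) / 2))"
    by (simp add: scaleR_conv_of_real)
  then show ?E
    by (simp only: integral_scaleR_right[symmetric] pt)
qed

definition gauss :: "'a::euclidean_space \<Rightarrow> complex" where
  "gauss x = of_real (exp (- ((norm x)\<^sup>2) / 2))"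

lemma gauss_prod_Basis:
  fixes x \<xi> :: "'a::euclidean_space"
  shows "exp (- \<i> * of_real (x \<bullet> \<xi>)) * gauss x =
    (\<Prod>b\<in>Basis. exp (- \<i> * of_real ((x \<bullet> b) * (\<xi> \<bullet> b))) * of_real (exp (- ((x \<bullet> b)\<^sup>2) / 2)))"
proof -
  have "(norm x)\<^sup>2 = (\<Sum>b\<in>Basis. (x \<bullet> b)\<^sup>2)"
    unfolding power2_norm_eq_inner by (subst euclidean_inner) (simp add: power2_eq_square)
  then have "exp (- ((norm x)\<^sup>2) / 2) = (\<Prod>b\<in>Basis. exp (- ((x \<bullet> b)\<^sup>2) / 2))"
    by (simp add: exp_sum[symmetric] sum_negf sum_divide_distrib)
  moreover have "exp (- \<i> * of_real (x \<bullet> \<xi>)) = (\<Prod>b\<in>Basis. exp (- \<i> * of_real ((x \<bullet> b) * (\<xi> \<bullet> b))))"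
    by (subst exp_sum[symmetric]) (auto simp: euclidean_inner[of x \<xi>] sum_distrib_left sum_negf)
  ultimately show ?thesis
    by (simp add: gauss_def prod.distrib)
qed

lemma
  fixes \<xi> :: "'a::euclidean_space"
  shows integrable_gauss_kernel: "integrable lborel (\<lambda>x. exp (- \<i> * of_real (x \<bullet> \<xi>)) * gauss x)"
    and integral_gauss_kernel:
      "(LINT x|lborel. exp (- \<i> * of_real (x \<bullet> \<xi>)) * gauss x) = of_real ((2 * pi) powr (real DIM('a) / 2)) * gauss \<xi>"
proof -
  note int = integrable_gaussian_fourier_kernel_real
  show "integrable lborel (\<lambda>x. exp (- \<i> * of_real (x \<bullet> \<xi>)) * gauss x)"
    unfolding gauss_prod_Basis by (rule integrable_lborel_prod_Basis[where f="\<lambda>b x. exp (- \<i> * of_real (x * (\<xi> \<bullet> b))) * of_real (exp (- (x\<^sup>2) / 2))"]) (rule int)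
  have "(LINT x|lborel. exp (- \<i> * of_real (x \<bullet> \<xi>)) * gauss x)
      = (\<Prod>b\<in>Basis. complex_of_real (sqrt (2 * pi) * exp (- ((\<xi> \<bullet> b)\<^sup>2) / 2)))"
    unfolding gauss_prod_Basis
    by (subst integral_lborel_prod_Basis[where f="\<lambda>b x. exp (- \<i> * of_real (x * (\<xi> \<bullet> b))) * of_real (exp (- (x\<^sup>2) / 2))"])
      (rule int, simp only: integral_gaussian_fourier_kernel_real)
  also have "\<dots> = of_real (sqrt (2 * pi) ^ DIM('a) * (\<Prod>b\<in>Basis. exp (- ((\<xi> \<bullet> b)\<^sup>2) / 2)))"
    by (simp add: prod.distrib)
  also have "(\<Prod>b\<in>Basis. exp (- ((\<xi> \<bullet> b)\<^sup>2) / 2)) = exp (- ((norm \<xi>)\<^sup>2) / 2)"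
    using gauss_prod_Basis[of \<xi> 0] by (simp add: gauss_def flip: of_real_prod)
  also have "sqrt (2 * pi) ^ DIM('a) = (2 * pi) powr (real DIM('a) / 2)"
    by (simp add: powr_half_sqrt[symmetric] powr_powr flip: powr_realpow)
  finally show "(LINT x|lborel. exp (- \<i> * of_real (x \<bullet> \<xi>)) * gauss x) = of_real ((2 * pi) powr (real DIM('a) / 2)) * gauss \<xi>"
    by (simp add: gauss_def)
qed

lemma integrable_gauss: "integrable lborel gauss"
  using integrable_gauss_kernel[of 0] by simp

lemma integral_gauss: "(LINT x|lborel. (gauss :: 'a::euclidean_space \<Rightarrow> complex) x) = of_real ((2 * pi) powr (real DIM('a) / 2))"
  using integral_gauss_kernel[of "0::'a"] by (simp add: gauss_def)

lemma borel_measurable_gauss [measurable]: "gauss \<in> borel_measurable borel"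
  unfolding gauss_def by measurable

lemma integrable_times_character:
  fixes f :: "'a::euclidean_space \<Rightarrow> complex"
  assumes "integrable lborel f"
  shows "integrable lborel (\<lambda>x. exp (- \<i> * of_real (x \<bullet> \<xi>)) * f x)"
  using assms by (rule Bochner_Integration.integrable_bound) (use assms in \<open>auto simp: norm_mult\<close>)

lemma borel_measurable_fourier_integral [measurable]:
  fixes f :: "'a::euclidean_space \<Rightarrow> complex"
  assumes [measurable]: "f \<in> borel_measurable borel"
  shows "fourier_integral f \<in> borel_measurable borel"
  unfolding fourier_integral_def by measurable

lemma norm_fourier_integral_le:
  fixes f :: "'a::euclidean_space \<Rightarrow> complex"
  assumes "integrable lborel f"
  shows "norm (fourier_integral f \<xi>) \<le> (2 * pi) powr (- real DIM('a) / 2) * (LINT x|lborel. norm (f x))"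
proof -
  have "norm (LINT x|lborel. exp (- \<i> * of_real (x \<bullet> \<xi>)) * f x) \<le> (LINT x|lborel. norm (exp (- \<i> * of_real (x \<bullet> \<xi>)) * f x))"
    by (rule integral_norm_bound)
  then show ?thesis
    by (simp add: fourier_integral_def norm_mult mult_left_mono)
qed

lemma continuous_fourier_integral:
  fixes f :: "'a::euclidean_space \<Rightarrow> complex"
  assumes "integrable lborel f"
  shows "continuous_on UNIV (fourier_integral f)"
proof -
  have "(\<lambda>n. LINT x|lborel. exp (- \<i> * of_real (x \<bullet> X n)) * f x) \<longlonglongrightarrow> (LINT x|lborel. exp (- \<i> * of_real (x \<bullet> \<xi>)) * f x)"
    if "X \<longlonglongrightarrow> \<xi>" for X \<xi>
    by (rule integral_dominated_convergence[where w="\<lambda>x. norm (f x)"])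
      (use assms that in \<open>auto simp: norm_mult intro!: tendsto_intros\<close>)
  then show ?thesis
    unfolding fourier_integral_def
    by (intro continuous_on_mult_left) (auto simp: continuous_on_sequentially o_def)
qed

text \<open>Fubini: both sides are the double integral of \<open>exp (- \<i> x \<bullet> \<xi>) a x b \<xi>\<close>.\<close>

lemma fourier_integral_exchange:
  fixes a b :: "'a::euclidean_space \<Rightarrow> complex"
  assumes a: "integrable lborel a" and b: "integrable lborel b"
  shows "(LINT \<xi>|lborel. fourier_integral a \<xi> * b \<xi>) = (LINT x|lborel. a x * fourier_integral b x)"
proof -
  define k where "k x \<xi> = exp (- \<i> * of_real (x \<bullet> \<xi>)) * (a x * b \<xi>)" for x \<xi> :: 'a
  have [measurable]: "a \<in> borel_measurable borel" "b \<in> borel_measurable borel"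
    using a b by (auto simp: integrable_iff_bounded)
  have nk: "norm (k x \<xi>) = norm (a x) * norm (b \<xi>)" for x \<xi>
    by (simp add: k_def norm_mult)
  have "integrable (lborel \<Otimes>\<^sub>M lborel) (case_prod k)"
  proof (rule lborel_pair.Fubini_integrable)
    show "case_prod k \<in> borel_measurable (lborel \<Otimes>\<^sub>M lborel)"
      unfolding k_def by measurable
    show "integrable lborel (\<lambda>x. LINT y|lborel. norm (case (x, y) of (x, y) \<Rightarrow> k x y))"
      using a by (simp add: nk)
    show "AE x in lborel. integrable lborel (\<lambda>y. case (x, y) of (x, y) \<Rightarrow> k x y)"
      using integrable_times_character[OF b] by (simp add: k_def mult.left_commute inner_commute)
  qed
  then have fub: "(LINT \<xi>|lborel. LINT x|lborel. k x \<xi>) = (LINT x|lborel. LINT \<xi>|lborel. k x \<xi>)"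
    by (rule lborel_pair.Fubini_integral)
  define c where "c = complex_of_real ((2 * pi) powr (- real DIM('a) / 2))"
  have 1: "fourier_integral a \<xi> * b \<xi> = c * (LINT x|lborel. k x \<xi>)" for \<xi>
    by (simp add: fourier_integral_def k_def c_def mult.assoc flip: integral_mult_left_zero)
  have 2: "a x * fourier_integral b x = c * (LINT \<xi>|lborel. k x \<xi>)" for x
  proof -
    have "(LINT \<xi>|lborel. k x \<xi>) = (LINT \<xi>|lborel. a x * (exp (- \<i> * of_real (\<xi> \<bullet> x)) * b \<xi>))"
      by (simp add: k_def mult.left_commute inner_commute)
    then show ?thesis by (simp add: fourier_integral_def c_def)
  qed
  show ?thesis
    unfolding 1 2 by (simp add: fub)
qed

section \<open>Parseval and Plancherel formulas\<close>

lemma integrable_gauss_dilated: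
  "\<epsilon> \<noteq> 0 \<Longrightarrow> integrable lborel (\<lambda>\<xi>::'a::euclidean_space. gauss (\<epsilon> *\<^sub>R \<xi>))"
  using integrable_lborel_affine_iff[of "gauss :: 'a \<Rightarrow> complex" \<epsilon> 0] integrable_gauss by simp

lemma borel_measurable_cnj [measurable]: "cnj \<in> borel_measurable borel"
  by (intro borel_measurable_continuous_onI continuous_intros)

lemma cnj_gauss [simp]: "cnj (gauss x) = gauss x"
  by (simp add: gauss_def)

lemma fourier_integral_modulated_gauss:
  fixes x y :: "'a::euclidean_space"
  assumes "0 < \<epsilon>"
  shows "fourier_integral (\<lambda>\<xi>. exp (\<i> * of_real (\<xi> \<bullet> x)) * gauss (\<epsilon> *\<^sub>R \<xi>)) y
    = gauss ((1 / \<epsilon>) *\<^sub>R (y - x)) / of_real (\<epsilon> ^ DIM('a))"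
proof -
  define z where "z = (1 / \<epsilon>) *\<^sub>R (y - x)"
  have "(LINT \<xi>|lborel. exp (- \<i> * of_real (\<xi> \<bullet> y)) * (exp (\<i> * of_real (\<xi> \<bullet> x)) * gauss (\<epsilon> *\<^sub>R \<xi>)))
      = (LINT \<xi>|lborel. (\<lambda>\<eta>. exp (- \<i> * of_real (\<eta> \<bullet> z)) * gauss \<eta>) (0 + \<epsilon> *\<^sub>R \<xi>))"
    using assms by (intro Bochner_Integration.integral_cong)
      (auto simp: z_def inner_diff_right right_diff_distrib simp flip: mult.assoc exp_add)
  also have "\<dots> = (LINT \<eta>|lborel. exp (- \<i> * of_real (\<eta> \<bullet> z)) * gauss \<eta>) / of_real (\<bar>\<epsilon>\<bar> ^ DIM('a))"
    using assms by (subst integral_lborel_affine) auto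
  also have "\<dots> = of_real ((2 * pi) powr (real DIM('a) / 2)) * gauss z / of_real (\<bar>\<epsilon>\<bar> ^ DIM('a))"
    by (simp only: integral_gauss_kernel)
  finally show ?thesis
    using assms by (simp add: fourier_integral_def z_def powr_minus)
qed

text \<open>Parseval's formula with a Gaussian cut-off in frequency, which makes it meaningful for functions that are only
  integrable. It comes from two exchanges of the Fourier integral: the first moves it from \<open>h\<close> to the Gaussian times
  \<open>cnj (fourier_integral k)\<close>, the second moves the transform of \<open>k\<close> onto a modulated Gaussian, whose transform
  is an explicit approximate identity.\<close>

lemma gauss_regularized_parseval:
  fixes h k :: "'a::euclidean_space \<Rightarrow> complex"
  assumes h: "integrable lborel h" and k: "integrable lborel k" and "0 < \<epsilon>"
  shows "(LINT \<xi>|lborel. gauss (\<epsilon> *\<^sub>R \<xi>) * (fourier_integral h \<xi> * cnj (fourier_integral k \<xi>)))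
    = of_real ((2 * pi) powr (- real DIM('a) / 2)) *
      (LINT x|lborel. h x * cnj (LINT z|lborel. k (x + \<epsilon> *\<^sub>R z) * gauss z))"
proof -
  have [measurable]: "h \<in> borel_measurable borel" "k \<in> borel_measurable borel"
    using h k by (auto simp: integrable_iff_bounded)
  define b where "b \<xi> = gauss (\<epsilon> *\<^sub>R \<xi>) * cnj (fourier_integral k \<xi>)" for \<xi> :: 'a
  have [measurable]: "b \<in> borel_measurable borel" unfolding b_def by measurable
  define C where "C = (2 * pi) powr (- real DIM('a) / 2) * (LINT x|lborel. norm (k x))"
  have C: "norm (fourier_integral k \<xi>) \<le> C" "0 \<le> C" for \<xi>
    unfolding C_def using norm_fourier_integral_le[OF k] by auto
  have "integrable lborel (\<lambda>\<xi>::'a. gauss (\<epsilon> *\<^sub>R \<xi>) * of_real C)"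
    using integrable_gauss_dilated[of \<epsilon>] \<open>0 < \<epsilon>\<close> by auto
  then have b: "integrable lborel b"
    by (rule Bochner_Integration.integrable_bound)
      (use C in \<open>auto simp: b_def norm_mult intro!: mult_left_mono\<close>)
  have fb: "fourier_integral b x = of_real ((2 * pi) powr (- real DIM('a) / 2)) * cnj (LINT z|lborel. k (x + \<epsilon> *\<^sub>R z) * gauss z)" for x
  proof -
    define w where "w \<xi> = exp (\<i> * of_real (\<xi> \<bullet> x)) * gauss (\<epsilon> *\<^sub>R \<xi>)" for \<xi> :: 'a
    have [measurable]: "w \<in> borel_measurable borel" unfolding w_def by measurable
    have "integrable lborel (\<lambda>\<xi>::'a. gauss (\<epsilon> *\<^sub>R \<xi>))"
      using integrable_gauss_dilated[of \<epsilon>] \<open>0 < \<epsilon>\<close> by auto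
    then have w: "integrable lborel w"
      by (rule Bochner_Integration.integrable_bound) (auto simp: w_def norm_mult)
    have "(LINT \<xi>|lborel. exp (- \<i> * of_real (\<xi> \<bullet> x)) * b \<xi>) = (LINT \<xi>|lborel. cnj (fourier_integral k \<xi> * w \<xi>))"
      by (intro Bochner_Integration.integral_cong) (auto simp: b_def w_def exp_cnj)
    also have "\<dots> = cnj (LINT \<xi>|lborel. fourier_integral k \<xi> * w \<xi>)" by (rule Bochner_Integration.integral_cnj)
    also have "(LINT \<xi>|lborel. fourier_integral k \<xi> * w \<xi>) = (LINT y|lborel. k y * fourier_integral w y)"
      by (rule fourier_integral_exchange[OF k w])
    also have "\<dots> = (LINT y|lborel. k y * gauss ((1 / \<epsilon>) *\<^sub>R (y - x)) / of_real (\<epsilon> ^ DIM('a)))"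
      unfolding w_def using fourier_integral_modulated_gauss[OF \<open>0 < \<epsilon>\<close>, of x] by simp
    also have "\<dots> = (LINT y|lborel. k y * gauss ((1 / \<epsilon>) *\<^sub>R (y - x))) / of_real (\<epsilon> ^ DIM('a))"
      by (rule integral_divide_zero)
    also have "\<dots> = (LINT z|lborel. (\<lambda>y. k y * gauss ((1 / \<epsilon>) *\<^sub>R (y - x))) (x + \<epsilon> *\<^sub>R z))"
      using \<open>0 < \<epsilon>\<close> by (subst integral_lborel_affine) auto
    finally show ?thesis
      using \<open>0 < \<epsilon>\<close> by (simp add: fourier_integral_def)
  qed
  have "(LINT \<xi>|lborel. gauss (\<epsilon> *\<^sub>R \<xi>) * (fourier_integral h \<xi> * cnj (fourier_integral k \<xi>)))
      = (LINT \<xi>|lborel. fourier_integral h \<xi> * b \<xi>)"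
    by (simp add: b_def mult_ac)
  also have "\<dots> = (LINT x|lborel. h x * fourier_integral b x)"
    by (rule fourier_integral_exchange[OF h b])
  also have "\<dots> = of_real ((2 * pi) powr (- real DIM('a) / 2)) *
      (LINT x|lborel. h x * cnj (LINT z|lborel. k (x + \<epsilon> *\<^sub>R z) * gauss z))"
    unfolding fb by (simp only: mult.left_commute[of "h x" for x] integral_mult_right_zero)
  finally show ?thesis .
qed

text \<open>Removing the cut-off. Averages of \<open>k\<close> against the shrinking Gaussian converge to \<open>k x\<close> wherever \<open>k\<close> is continuous,
  and dominated convergence does the rest. Continuity almost everywhere is the right generality: it admits
  indicators of boxes and continuous functions truncated to balls, which are the functions that occur below.\<close>

lemma gauss_regularized_parseval_tendsto:
  fixes h k :: "'a::euclidean_space \<Rightarrow> complex"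
  assumes h: "integrable lborel h" and k: "integrable lborel k"
    and kB: "\<And>x. norm (k x) \<le> B" and kc: "AE x in lborel. isCont k x"
    and \<epsilon>: "\<And>m. 0 < \<epsilon> m" "\<epsilon> \<longlonglongrightarrow> 0"
  shows "(\<lambda>m. LINT \<xi>|lborel. gauss (\<epsilon> m *\<^sub>R \<xi>) * (fourier_integral h \<xi> * cnj (fourier_integral k \<xi>)))
    \<longlonglongrightarrow> (LINT x|lborel. h x * cnj (k x))"
proof -
  have [measurable]: "h \<in> borel_measurable borel" "k \<in> borel_measurable borel"
    using h k by (auto simp: integrable_iff_bounded)
  define G where "G = (LINT z|lborel. norm ((gauss :: 'a \<Rightarrow> complex) z))"
  define I where "I m x = (LINT z|lborel. k (x + \<epsilon> m *\<^sub>R z) * gauss z)" for m x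
  have [measurable]: "I m \<in> borel_measurable borel" for m
    unfolding I_def by measurable
  have Bgauss: "integrable lborel (\<lambda>z::'a. B * norm (gauss z))"
    using integrable_norm[OF integrable_gauss] by auto
  have bnd: "norm (k y * gauss z) \<le> B * norm (gauss z)" for y z
    using kB by (simp add: norm_mult mult_right_mono)
  have I_bound: "norm (I m x) \<le> B * G" for m x
  proof -
    have "norm (I m x) \<le> (LINT z|lborel. B * norm ((gauss :: 'a \<Rightarrow> complex) z))"
      unfolding I_def
    proof (rule Bochner_Integration.integral_norm_bound_integral[OF _ Bgauss bnd])
      show "integrable lborel (\<lambda>z. k (x + \<epsilon> m *\<^sub>R z) * gauss z)"
        using Bgauss by (rule Bochner_Integration.integrable_bound)
          (use bnd in \<open>auto intro!: AE_I2 order_trans[OF bnd abs_ge_self]\<close>)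
    qed
    then show ?thesis by (simp add: G_def)
  qed
  have I_lim: "(\<lambda>m. I m x) \<longlonglongrightarrow> k x * of_real ((2 * pi) powr (real DIM('a) / 2))" if "isCont k x" for x
  proof -
    have "(\<lambda>m. I m x) \<longlonglongrightarrow> (LINT z::'a|lborel. k x * gauss z)"
      unfolding I_def
    proof (rule integral_dominated_convergence[where w="\<lambda>z::'a. B * norm (gauss z)"])
      have "(\<lambda>m. x + \<epsilon> m *\<^sub>R z) \<longlonglongrightarrow> x + 0 *\<^sub>R z" for z
        using \<epsilon>(2) by (intro tendsto_intros)
      then have "(\<lambda>m. k (x + \<epsilon> m *\<^sub>R z)) \<longlonglongrightarrow> k x" for z
        using isCont_tendsto_compose[OF that, of _ sequentially] by (simp only: scaleR_zero_left add_0_right)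
      then show "AE z in lborel. (\<lambda>m. k (x + \<epsilon> m *\<^sub>R z) * gauss z) \<longlonglongrightarrow> k x * gauss z"
        by (intro AE_I2 tendsto_intros)
    qed (use bnd Bgauss in auto)
    then show ?thesis by (simp add: integral_gauss)
  qed
  define c where "c = complex_of_real ((2 * pi) powr (- real DIM('a) / 2))"
  have "(\<lambda>m. c * (LINT x|lborel. h x * cnj (I m x))) \<longlonglongrightarrow>
      c * (LINT x|lborel. h x * cnj (k x * of_real ((2 * pi) powr (real DIM('a) / 2))))"
  proof (intro tendsto_mult_left integral_dominated_convergence[where w="\<lambda>x. norm (h x) * (B * G)"])
    show "AE x in lborel. (\<lambda>m. h x * cnj (I m x)) \<longlonglongrightarrow> h x * cnj (k x * of_real ((2 * pi) powr (real DIM('a) / 2)))"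
      using kc by eventually_elim (intro tendsto_intros I_lim)
    show "AE x in lborel. norm (h x * cnj (I m x)) \<le> norm (h x) * (B * G)" for m
      by (intro AE_I2) (simp add: norm_mult mult_left_mono I_bound)
  qed (use h in auto)
  moreover have "c * (LINT x|lborel. h x * cnj (k x * of_real ((2 * pi) powr (real DIM('a) / 2)))) = (LINT x|lborel. h x * cnj (k x))"
    by (simp add: c_def powr_minus mult.assoc[symmetric])
  moreover have "(LINT \<xi>|lborel. gauss (\<epsilon> m *\<^sub>R \<xi>) * (fourier_integral h \<xi> * cnj (fourier_integral k \<xi>)))
      = c * (LINT x|lborel. h x * cnj (I m x))" for m
    unfolding I_def c_def by (rule gauss_regularized_parseval[OF h k \<epsilon>(1)])
  ultimately show ?thesis by (simp only:)
qed

text \<open>The diagonal case \<open>k = h\<close>: as the cut-off is removed, the regularized energies of the transform increase to its full energy.\<close>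

theorem plancherel_nn_integral:
  fixes h :: "'a::euclidean_space \<Rightarrow> complex"
  assumes h: "integrable lborel h" and hB: "\<And>x. norm (h x) \<le> B" and hc: "AE x in lborel. isCont h x"
  shows "(\<integral>\<^sup>+ \<xi>. ennreal ((cmod (fourier_integral h \<xi>))\<^sup>2) \<partial>lborel) = ennreal (LINT x|lborel. (cmod (h x))\<^sup>2)"
proof -
  have [measurable]: "h \<in> borel_measurable borel"
    using h by (auto simp: integrable_iff_bounded)
  define \<epsilon> where "\<epsilon> m = 1 / real (Suc m)" for m
  have \<epsilon>: "\<And>m. 0 < \<epsilon> m" "\<epsilon> \<longlonglongrightarrow> 0"
    using LIMSEQ_inverse_real_of_nat by (auto simp: \<epsilon>_def[abs_def] inverse_eq_divide)
  define g where "g m \<xi> = exp (- (\<epsilon> m * norm \<xi>)\<^sup>2 / 2) * (cmod (fourier_integral h \<xi>))\<^sup>2" for m and \<xi> :: 'a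
  have [measurable]: "g m \<in> borel_measurable borel" for m unfolding g_def by measurable
  have g_eq: "gauss (\<epsilon> m *\<^sub>R \<xi>) * (fourier_integral h \<xi> * cnj (fourier_integral h \<xi>)) = of_real (g m \<xi>)" for m \<xi>
    by (simp add: g_def gauss_def complex_norm_square[symmetric] power_mult_distrib)
  have g_int: "integrable lborel (g m)" for m
  proof -
    define C where "C = (2 * pi) powr (- real DIM('a) / 2) * (LINT x|lborel. norm (h x))"
    have C: "norm (fourier_integral h \<xi>) \<le> C" for \<xi>
      unfolding C_def using norm_fourier_integral_le[OF h] by auto
    have "integrable lborel (\<lambda>\<xi>::'a. norm (gauss (\<epsilon> m *\<^sub>R \<xi>)) * C\<^sup>2)"
      using integrable_norm[OF integrable_gauss_dilated[of "\<epsilon> m"]] \<epsilon>(1)[of m] by auto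
    then show ?thesis
      by (rule Bochner_Integration.integrable_bound)
        (use C in \<open>auto simp: g_def gauss_def power_mult_distrib intro!: power_mono mult_left_mono\<close>)
  qed
  have "(\<lambda>m. complex_of_real (LINT \<xi>|lborel. g m \<xi>)) \<longlonglongrightarrow> (LINT x|lborel. h x * cnj (h x))"
    using gauss_regularized_parseval_tendsto[OF h h hB hc \<epsilon>] by (simp add: g_eq)
  also have "(LINT x|lborel. h x * cnj (h x)) = complex_of_real (LINT x|lborel. (cmod (h x))\<^sup>2)"
    by (simp only: complex_norm_square[symmetric] integral_complex_of_real)
  finally have "(\<lambda>m. LINT \<xi>|lborel. g m \<xi>) \<longlonglongrightarrow> (LINT x|lborel. (cmod (h x))\<^sup>2)"
    by (simp only: tendsto_of_real_iff)
  then have "(\<lambda>m. ennreal (LINT \<xi>|lborel. g m \<xi>)) \<longlonglongrightarrow> ennreal (LINT x|lborel. (cmod (h x))\<^sup>2)"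
    by (rule tendsto_ennrealI)
  moreover have "ennreal (LINT \<xi>|lborel. g m \<xi>) = (\<integral>\<^sup>+ \<xi>. ennreal (g m \<xi>) \<partial>lborel)" for m
    by (rule nn_integral_eq_integral[OF g_int, symmetric]) (simp add: g_def)
  ultimately have lim1: "(\<lambda>m. \<integral>\<^sup>+ \<xi>. ennreal (g m \<xi>) \<partial>lborel) \<longlonglongrightarrow> ennreal (LINT x|lborel. (cmod (h x))\<^sup>2)"
    by simp
  have "(\<lambda>m. \<integral>\<^sup>+ \<xi>. ennreal (g m \<xi>) \<partial>lborel) \<longlonglongrightarrow> (\<integral>\<^sup>+ \<xi>. ennreal ((cmod (fourier_integral h \<xi>))\<^sup>2) \<partial>lborel)"
  proof (rule nn_integral_LIMSEQ)
    have "\<epsilon> n \<le> \<epsilon> m" if "m \<le> n" for m n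
      using that by (simp add: \<epsilon>_def field_simps)
    then have "g m \<xi> \<le> g n \<xi>" if "m \<le> n" for m n \<xi>
      using that less_imp_le[OF \<epsilon>(1)] unfolding g_def by (auto intro!: mult_right_mono power_mono)
    then show "incseq (\<lambda>m \<xi>. ennreal (g m \<xi>))"
      by (auto simp: mono_def le_fun_def intro: ennreal_leI)
    have "(\<lambda>m. g m \<xi>) \<longlonglongrightarrow> exp (- (0 * norm \<xi>)\<^sup>2 / 2) * (cmod (fourier_integral h \<xi>))\<^sup>2" for \<xi>
      unfolding g_def by (intro tendsto_intros \<epsilon>(2)) auto
    then show "(\<lambda>m. ennreal (g m \<xi>)) \<longlonglongrightarrow> ennreal ((cmod (fourier_integral h \<xi>))\<^sup>2)" for \<xi>
      by (intro tendsto_ennrealI) simp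
  qed auto
  with lim1 show ?thesis by (rule LIMSEQ_unique[symmetric])
qed

lemma
  fixes h :: "'a::euclidean_space \<Rightarrow> complex"
  assumes h: "integrable lborel h" and hB: "\<And>x. norm (h x) \<le> B" and hc: "AE x in lborel. isCont h x"
  shows integrable_norm_fourier_integral_square: "integrable lborel (\<lambda>\<xi>. (cmod (fourier_integral h \<xi>))\<^sup>2)" (is ?I)
    and plancherel_integral: "(LINT \<xi>|lborel. (cmod (fourier_integral h \<xi>))\<^sup>2) = (LINT x|lborel. (cmod (h x))\<^sup>2)" (is ?E)
proof -
  have [measurable]: "h \<in> borel_measurable borel"
    using h by (auto simp: integrable_iff_bounded)
  note P = plancherel_nn_integral[OF assms]
  show ?I by (rule integrableI_bounded) (use P in auto)
  then show ?E using P by (subst (asm) nn_integral_eq_integral) auto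
qed

section \<open>Uniqueness and injectivity of the Plancherel transform\<close>

lemma ball_in_borel [measurable]: "ball x r \<in> sets borel" and box_in_borel [measurable]: "box a b \<in> sets borel"
  by auto

lemma integrable_L2_on_bounded:
  fixes f :: "'a::euclidean_space \<Rightarrow> complex"
  assumes f: "f \<in> L2" and A: "A \<in> sets borel" "bounded A"
  shows "integrable lborel (\<lambda>x. indicator A x * f x)"
proof -
  have [measurable]: "f \<in> borel_measurable borel" "A \<in> sets borel" and f2: "integrable lborel (\<lambda>x. (cmod (f x))\<^sup>2)"
    using f A by (auto simp: L2_def)
  have "integrable lborel (indicator A :: 'a \<Rightarrow> real)"
    using A emeasure_bounded_finite by (intro integrable_real_indicator) auto
  then have "integrable lborel (\<lambda>x. indicator A x + (cmod (f x))\<^sup>2)"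
    using f2 by auto
  then show ?thesis
  proof (rule Bochner_Integration.integrable_bound)
    have "norm (f x) \<le> 1 + (norm (f x))\<^sup>2" for x
      using sum_squares_bound[of "norm (f x)" 1] by (smt (verit) norm_ge_zero one_power2 zero_le_power2)
    then show "AE x in lborel. norm (indicator A x * f x) \<le> norm (indicator A x + (cmod (f x))\<^sup>2)"
      by (auto split: split_indicator)
  qed auto
qed

lemma AE_isCont_indicator_times:
  fixes f :: "'a::euclidean_space \<Rightarrow> complex"
  assumes "negligible (frontier A)" "\<And>x. isCont f x"
  shows "AE x in lborel. isCont (\<lambda>x. indicator A x * f x) x"
proof -
  have "frontier A \<in> null_sets lebesgue" using assms(1) by (simp add: negligible_iff_null_sets)
  then have "frontier A \<in> null_sets lborel"
    by (simp add: null_sets_completion_iff)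
  then have "AE x in lborel. x \<notin> frontier A" by (rule AE_not_in)
  then show ?thesis
  proof eventually_elim
    case (elim x)
    then consider "x \<in> interior A" | "x \<in> interior (- A)"
      by (auto simp: frontier_def interior_complement)
    then show ?case
    proof cases
      case 1
      then have "\<forall>\<^sub>F y in nhds x. indicator A y * f y = f y"
        by (intro eventually_mono[OF eventually_nhds_in_open[OF open_interior 1]])
          (use interior_subset in \<open>auto simp: indicator_def\<close>)
      then show ?thesis using assms(2) isCont_cong by fast
    next
      case 2
      then have "\<forall>\<^sub>F y in nhds x. indicator A y * f y = 0"
        by (intro eventually_mono[OF eventually_nhds_in_open[OF open_interior 2]])
          (use interior_subset in \<open>auto simp: indicator_def\<close>)
      then show ?thesis using isCont_cong[of _ "\<lambda>_. 0"] continuous_const by fast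
    qed
  qed
qed

text \<open>Boxes form an intersection-stable generator of the Borel sets, so the vanishing of the integrals extends to
  all Borel subsets of a large box \<open>W N\<close>; the boxes \<open>W N\<close> exhaust the space.\<close>

lemma AE_zero_if_box_integrals_zero:
  fixes u :: "'a::euclidean_space \<Rightarrow> complex"
  assumes int: "\<And>a b. integrable lborel (\<lambda>x. indicator (box a b) x * u x)"
    and zero: "\<And>a b. (LINT x|lborel. indicator (box a b) x * u x) = 0"
  shows "AE x in lborel. u x = 0"
proof -
  define W where "W N = box (- (real N *\<^sub>R One)) (real N *\<^sub>R One :: 'a)" for N
  have W0: "AE x in lborel. indicator (W N) x * u x = 0" for N
  proof (rule sigma_finite_measure.density_zero[OF sigma_finite_lborel])
    show intW: "integrable lborel (\<lambda>x. indicator (W N) x * u x)"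
      unfolding W_def by (rule int)
    have [measurable]: "(\<lambda>x. indicator (W N) x * u x) \<in> borel_measurable borel"
      using intW by (simp add: integrable_iff_bounded)
    fix A assume "A \<in> sets (lborel :: 'a measure)"
    then have A: "A \<in> sigma_sets UNIV (range (\<lambda>(a, b). box a b :: 'a set))"
      by (simp add: borel_eq_box)
    have "Int_stable (range (\<lambda>(a, b). box a b :: 'a set))"
      by (auto simp: Int_stable_def box_Int_box)
    moreover have "range (\<lambda>(a, b). box a b :: 'a set) \<subseteq> Pow UNIV" by simp
    moreover note A
    ultimately show "set_lebesgue_integral lborel A (\<lambda>x. indicator (W N) x * u x) = 0"
    proof (induction rule: sigma_sets_induct_disjoint)
      case (basic A)
      then obtain a b where A: "A = box a b" by auto
      obtain c d where cd: "box a b \<inter> W N = box c d"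
        unfolding W_def box_Int_box by blast
      have "x \<in> box c d \<longleftrightarrow> x \<in> A \<and> x \<in> W N" for x
        using cd A by blast
      then have "set_lebesgue_integral lborel A (\<lambda>x. indicator (W N) x * u x) = (LINT x|lborel. indicator (box c d) x * u x)"
        unfolding set_lebesgue_integral_def
        by (intro Bochner_Integration.integral_cong) (auto simp: indicator_def)
      then show ?case using zero[of c d] by simp
    next
      case empty
      show ?case by (simp add: set_lebesgue_integral_def)
    next
      case (compl A)
      then have A: "A \<in> sets borel" by (simp add: borel_eq_box)
      have "set_lebesgue_integral lborel (UNIV - A) (\<lambda>x. indicator (W N) x * u x)
          = (LINT x|lborel. indicator (W N) x * u x - indicator A x *\<^sub>R (indicator (W N) x * u x))"
        unfolding set_lebesgue_integral_def
        by (intro Bochner_Integration.integral_cong) (auto split: split_indicator)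
      also have "\<dots> = (LINT x|lborel. indicator (W N) x * u x) - set_lebesgue_integral lborel A (\<lambda>x. indicator (W N) x * u x)"
        unfolding set_lebesgue_integral_def
        using A intW by (intro Bochner_Integration.integral_diff integrable_mult_indicator) auto
      also have "\<dots> = 0"
        using zero compl by (simp add: W_def)
      finally show ?case .
    next
      case (union A)
      then have A: "\<And>i. A i \<in> sets lborel" by (auto simp: borel_eq_box)
      have "(\<Union>i. A i) \<in> sets lborel" using A by auto
      then have "set_integrable lborel (\<Union>i. A i) (\<lambda>x. indicator (W N) x * u x)"
        unfolding set_integrable_def using intW by (intro integrable_mult_indicator) auto
      then have "set_lebesgue_integral lborel (\<Union>i. A i) (\<lambda>x. indicator (W N) x * u x)
          = (\<Sum>i. set_lebesgue_integral lborel (A i) (\<lambda>x. indicator (W N) x * u x))"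
        using A union by (intro lebesgue_integral_countable_add) (auto simp: disjoint_family_on_def)
      then show ?case using union by simp
    qed
  qed
  have "AE x in lborel. \<forall>N. indicator (W N) x * u x = 0"
    unfolding AE_all_countable by (intro allI W0)
  then show ?thesis
  proof eventually_elim
    case (elim x)
    obtain N :: nat where N: "norm x < N" using reals_Archimedean2 by blast
    have "x \<in> W N"
      using Basis_le_norm[of _ x] N by (fastforce simp: W_def mem_box abs_le_iff inner_sum_left_Basis)
    then show ?case using elim[rule_format, of N] by simp
  qed
qed

lemma fourier_L2_unique:
  assumes F: "has_fourier_L2 f F" and F': "has_fourier_L2 f F'"
  shows "AE \<xi> in lborel. F \<xi> = F' \<xi>"
proof -
  define T where "T R = fourier_integral (\<lambda>x. indicator (ball 0 R) x * f x)" for R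
  define d where "d F R = (\<integral>\<^sup>+ \<xi>. ennreal ((cmod (F \<xi> - T R \<xi>))\<^sup>2) \<partial>lborel)" for F R
  have [measurable]: "f \<in> borel_measurable borel" "F \<in> borel_measurable borel" "F' \<in> borel_measurable borel"
    using F F' by (auto simp: has_fourier_L2_def L2_def)
  have [measurable]: "T R \<in> borel_measurable borel" for R unfolding T_def by measurable
  have lim: "(d F \<longlongrightarrow> 0) at_top" "(d F' \<longlongrightarrow> 0) at_top"
    using F F' by (auto simp: has_fourier_L2_def d_def[abs_def] T_def)
  have le: "(\<integral>\<^sup>+ \<xi>. ennreal ((cmod (F \<xi> - F' \<xi>))\<^sup>2) \<partial>lborel) \<le> 2 * d F R + 2 * d F' R" for R
  proof -
    have "(cmod (a - b))\<^sup>2 \<le> 2 * (cmod (a - c))\<^sup>2 + 2 * (cmod (b - c))\<^sup>2" for a b c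
    proof -
      have "cmod (a - b) \<le> cmod (a - c) + cmod (b - c)" by (metis dist_norm dist_triangle2)
      then have "(cmod (a - b))\<^sup>2 \<le> (cmod (a - c) + cmod (b - c))\<^sup>2" by (intro power_mono) auto
      also have "\<dots> \<le> 2 * (cmod (a - c))\<^sup>2 + 2 * (cmod (b - c))\<^sup>2"
        using sum_squares_bound[of "cmod (a - c)" "cmod (b - c)"] by (simp add: power2_sum)
      finally show ?thesis .
    qed
    then have "ennreal ((cmod (F \<xi> - F' \<xi>))\<^sup>2) \<le> 2 * ennreal ((cmod (F \<xi> - T R \<xi>))\<^sup>2) + 2 * ennreal ((cmod (F' \<xi> - T R \<xi>))\<^sup>2)" for \<xi>
      by (auto simp: ennreal_mult'[symmetric] simp flip: ennreal_plus ennreal_numeral intro!: ennreal_leI)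
    then have "(\<integral>\<^sup>+ \<xi>. ennreal ((cmod (F \<xi> - F' \<xi>))\<^sup>2) \<partial>lborel) \<le>
      (\<integral>\<^sup>+ \<xi>. 2 * ennreal ((cmod (F \<xi> - T R \<xi>))\<^sup>2) + 2 * ennreal ((cmod (F' \<xi> - T R \<xi>))\<^sup>2) \<partial>lborel)"
      by (intro nn_integral_mono) auto
    also have "\<dots> = 2 * d F R + 2 * d F' R"
      by (simp add: nn_integral_add nn_integral_cmult d_def)
    finally show ?thesis .
  qed
  have "((\<lambda>R. 2 * d F R + 2 * d F' R) \<longlongrightarrow> 2 * 0 + 2 * 0) at_top"
    by (intro tendsto_add ennreal_tendsto_cmult lim) auto
  then have "(\<integral>\<^sup>+ \<xi>. ennreal ((cmod (F \<xi> - F' \<xi>))\<^sup>2) \<partial>lborel) \<le> 2 * 0 + 2 * 0"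
    by (rule tendsto_lowerbound) (auto intro!: always_eventually le)
  then show ?thesis
    by (simp add: nn_integral_0_iff_AE)
qed

text \<open>The complement of the support is a union of open sets that may be uncountable; Lindelof's theorem reduces it to
  countably many null sets.\<close>

lemma AE_zero_outside_ess_supp:
  fixes f :: "'a::euclidean_space \<Rightarrow> complex"
  shows "AE x in lborel. x \<notin> ess_supp f \<longrightarrow> f x = 0"
proof -
  define \<F> where "\<F> = {V :: 'a set. open V \<and> (AE x in lborel. x \<in> V \<longrightarrow> f x = 0)}"
  obtain \<G> where \<G>: "\<G> \<subseteq> \<F>" "countable \<G>" "\<Union>\<G> = \<Union>\<F>"
    using Lindelof[of \<F>] unfolding \<F>_def by blast
  have "AE x in lborel. \<forall>V\<in>\<G>. x \<in> V \<longrightarrow> f x = 0"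
    using \<G> by (intro AE_ball_countable') (auto simp: \<F>_def)
  then show ?thesis
  proof eventually_elim
    case (elim x)
    have "x \<in> \<Union>\<G>" if "x \<notin> ess_supp f"
      using that unfolding \<G>(3) ess_supp_def \<F>_def by blast
    then show ?case using elim by blast
  qed
qed

text \<open>Truncating to a ball that contains the support changes nothing, so the \<open>L\<^sup>2\<close> limit is eventually constant.\<close>

lemma fourier_L2_eq_fourier_integral:
  assumes F: "has_fourier_L2 f F" and supp: "ess_supp f \<subseteq> ball 0 r"
  shows "AE \<xi> in lborel. F \<xi> = fourier_integral (\<lambda>x. indicator (ball 0 r) x * f x) \<xi>"
proof -
  have [measurable]: "f \<in> borel_measurable borel" "F \<in> borel_measurable borel"
    using F by (auto simp: has_fourier_L2_def L2_def)
  have eq: "fourier_integral (\<lambda>x. indicator (ball 0 R) x * f x) \<xi> = fourier_integral (\<lambda>x. indicator (ball 0 r) x * f x) \<xi>"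
    if "r \<le> R" for R \<xi>
  proof -
    have "AE x in lborel. indicator (ball 0 R) x * f x = indicator (ball 0 r) x * f x"
      using AE_zero_outside_ess_supp[of f] by eventually_elim (use supp that in \<open>auto split: split_indicator\<close>)
    then have "AE x in lborel. exp (- \<i> * of_real (x \<bullet> \<xi>)) * (indicator (ball 0 R) x * f x) = exp (- \<i> * of_real (x \<bullet> \<xi>)) * (indicator (ball 0 r) x * f x)"
      by eventually_elim simp
    then show ?thesis
      unfolding fourier_integral_def by (intro arg_cong2[where f="(*)"] refl integral_cong_AE) auto
  qed
  have "\<forall>\<^sub>F R in at_top. (\<integral>\<^sup>+ \<xi>. ennreal ((cmod (F \<xi> - fourier_integral (\<lambda>x. indicator (ball 0 R) x * f x) \<xi>))\<^sup>2) \<partial>lborel)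
    = (\<integral>\<^sup>+ \<xi>. ennreal ((cmod (F \<xi> - fourier_integral (\<lambda>x. indicator (ball 0 r) x * f x) \<xi>))\<^sup>2) \<partial>lborel)"
    by (intro eventually_mono[OF eventually_ge_at_top[of r]], subst eq) auto
  then have "((\<lambda>R::real. \<integral>\<^sup>+ \<xi>. ennreal ((cmod (F \<xi> - fourier_integral (\<lambda>x. indicator (ball 0 r) x * f x) \<xi>))\<^sup>2) \<partial>lborel) \<longlongrightarrow> 0) at_top"
    by (rule Lim_transform_eventually[rotated]) (use F in \<open>simp add: has_fourier_L2_def\<close>)
  then have "(\<integral>\<^sup>+ \<xi>. ennreal ((cmod (F \<xi> - fourier_integral (\<lambda>x. indicator (ball 0 r) x * f x) \<xi>))\<^sup>2) \<partial>lborel) = 0"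
    by (simp add: tendsto_const_iff)
  then show ?thesis by (simp add: nn_integral_0_iff_AE)
qed

text \<open>Test \<open>u\<close> against the indicator \<open>k\<close> of a box. The regularized Parseval formula for \<open>k\<close> and a truncation of \<open>u\<close> bounds the
  integral of \<open>u\<close> over the box by the energy of the transform of the truncation, which tends to \<open>0\<close>, and the energy of the
  transform of \<open>k\<close>, which is finite by Plancherel. Thus all integrals over boxes vanish.\<close>

lemma fourier_L2_injective:
  fixes u :: "'a::euclidean_space \<Rightarrow> complex"
  assumes U: "has_fourier_L2 u U" and U0: "AE \<xi> in lborel. U \<xi> = 0"
  shows "AE x in lborel. u x = 0"
proof (rule AE_zero_if_box_integrals_zero)
  fix a b :: 'a
  have uL2: "u \<in> L2" using U by (simp add: has_fourier_L2_def)
  then have [measurable]: "u \<in> borel_measurable borel" by (simp add: L2_def)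
  show "integrable lborel (\<lambda>x. indicator (box a b) x * u x)"
    by (rule integrable_L2_on_bounded[OF uL2]) (auto simp: bounded_box)
  define k where "k x = (indicator (box a b) x :: complex)" for x
  define uR where "uR R x = indicator (ball 0 R) x * u x" for R x
  define N where "N R = (\<integral>\<^sup>+ \<xi>. ennreal ((cmod (fourier_integral (uR R) \<xi>))\<^sup>2) \<partial>lborel)" for R
  have [measurable]: "uR R \<in> borel_measurable borel" "k \<in> borel_measurable borel" for R
    unfolding uR_def k_def by measurable
  have N_lim: "(N \<longlongrightarrow> 0) at_top"
  proof -
    have "N R = (\<integral>\<^sup>+ \<xi>. ennreal ((cmod (U \<xi> - fourier_integral (uR R) \<xi>))\<^sup>2) \<partial>lborel)" for R
      unfolding N_def using U0 by (intro nn_integral_cong_AE) (auto elim: eventually_mono)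
    then have "N = (\<lambda>R. \<integral>\<^sup>+ \<xi>. ennreal ((cmod (U \<xi> - fourier_integral (\<lambda>x. indicator (ball 0 R) x * u x) \<xi>))\<^sup>2) \<partial>lborel)"
      by (intro ext) (simp only: uR_def[abs_def])
    then show ?thesis using U by (simp add: has_fourier_L2_def)
  qed
  have uR: "integrable lborel (uR R)" for R
    unfolding uR_def by (rule integrable_L2_on_bounded[OF uL2]) auto
  have k: "integrable lborel k"
  proof -
    have "integrable lborel (\<lambda>x. complex_of_real (indicator (box a b) x))"
      by (intro integrable_of_real integrable_real_indicator) (auto simp: emeasure_lborel_box_eq)
    also have "(\<lambda>x. complex_of_real (indicator (box a b) x)) = k"
      by (auto simp: k_def fun_eq_iff split: split_indicator)
    finally show ?thesis .
  qed
  have kB: "norm (k x) \<le> 1" for x by (simp add: k_def split: split_indicator)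
  have kc: "AE x in lborel. isCont k x"
    using AE_isCont_indicator_times[of "box a b" "\<lambda>_. 1"] by (simp add: k_def[abs_def] negligible_convex_frontier)
  \<comment> \<open>\<open>P\<close> is the energy of \<open>k\<close>, hence also that of its transform. Weighting the two energies by \<open>c\<close> and \<open>1 / c\<close>
    replaces the Cauchy-Schwarz inequality: the first vanishes as the truncation is removed, the second as \<open>c\<close> grows.\<close>
  define P where "P = (LINT x|lborel. (cmod (k x))\<^sup>2)"
  define v where "v = (LINT x|lborel. indicator (box a b) x * u x)"
  have v_le: "ennreal (norm v) \<le> ennreal c * N R + ennreal (P / c)" if "0 < c" "box a b \<subseteq> ball 0 R" for c R
  proof -
    define \<epsilon> where "\<epsilon> m = 1 / real (Suc m)" for m
    have \<epsilon>: "\<And>m. 0 < \<epsilon> m" "\<epsilon> \<longlonglongrightarrow> 0"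
      using LIMSEQ_inverse_real_of_nat by (auto simp: \<epsilon>_def[abs_def] inverse_eq_divide)
    have eq: "(LINT x|lborel. uR R x * cnj (k x)) = v"
      unfolding v_def using that(2) by (intro Bochner_Integration.integral_cong) (auto simp: uR_def k_def split: split_indicator)
    have lim: "(\<lambda>m. LINT \<xi>|lborel. gauss (\<epsilon> m *\<^sub>R \<xi>) * (fourier_integral (uR R) \<xi> * cnj (fourier_integral k \<xi>))) \<longlonglongrightarrow> v"
      using gauss_regularized_parseval_tendsto[OF uR k kB kc \<epsilon>, of R] unfolding eq .
    have bnd: "ennreal (norm (LINT \<xi>|lborel. gauss (\<epsilon> m *\<^sub>R \<xi>) * (fourier_integral (uR R) \<xi> * cnj (fourier_integral k \<xi>)))) \<le> ennreal c * N R + ennreal (P / c)" for m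
    proof -
      have pt: "norm (gauss (\<epsilon> m *\<^sub>R \<xi>) * (x * cnj y)) \<le> c * (norm x)\<^sup>2 + (norm y)\<^sup>2 / c" for x y and \<xi> :: 'a
      proof -
        have "norm (gauss (\<epsilon> m *\<^sub>R \<xi>)) \<le> 1" by (simp add: gauss_def)
        then have "norm (gauss (\<epsilon> m *\<^sub>R \<xi>) * (x * cnj y)) \<le> norm x * norm y"
          by (simp add: norm_mult mult_left_le_one_le)
        also have "norm x * norm y = (sqrt c * norm x) * (norm y / sqrt c)"
          using \<open>0 < c\<close> by simp
        also have "\<dots> \<le> (sqrt c * norm x)\<^sup>2 + (norm y / sqrt c)\<^sup>2"
        proof -
          have "p * q \<le> p\<^sup>2 + q\<^sup>2" if "0 \<le> p" "0 \<le> q" for p q :: real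
            using sum_squares_bound[of p q] mult_nonneg_nonneg[OF that] by linarith
          then show ?thesis using \<open>0 < c\<close> by (meson divide_nonneg_nonneg mult_nonneg_nonneg norm_ge_zero real_sqrt_ge_zero less_imp_le)
        qed
        finally show ?thesis using \<open>0 < c\<close> by (simp add: power_mult_distrib power_divide)
      qed
      have "ennreal (norm (LINT \<xi>|lborel. gauss (\<epsilon> m *\<^sub>R \<xi>) * (fourier_integral (uR R) \<xi> * cnj (fourier_integral k \<xi>))))
          \<le> (\<integral>\<^sup>+ \<xi>. ennreal (c * (norm (fourier_integral (uR R) \<xi>))\<^sup>2 + (norm (fourier_integral k \<xi>))\<^sup>2 / c) \<partial>lborel)"
      proof (cases "integrable lborel (\<lambda>\<xi>. gauss (\<epsilon> m *\<^sub>R \<xi>) * (fourier_integral (uR R) \<xi> * cnj (fourier_integral k \<xi>)))")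
        case True
        show ?thesis
          by (rule order_trans[OF integral_norm_bound_ennreal[OF True] nn_integral_mono]) (intro ennreal_leI pt)
      qed (simp add: not_integrable_integral_eq)
      also have "\<dots> = (\<integral>\<^sup>+ \<xi>. ennreal c * ennreal ((norm (fourier_integral (uR R) \<xi>))\<^sup>2) + ennreal (1 / c) * ennreal ((norm (fourier_integral k \<xi>))\<^sup>2) \<partial>lborel)"
        using \<open>0 < c\<close> by (intro nn_integral_cong) (simp add: ennreal_mult'[symmetric] flip: ennreal_plus)
      also have "\<dots> = ennreal c * N R + ennreal (1 / c) * ennreal P"
        unfolding P_def plancherel_nn_integral[OF k kB kc, symmetric] N_def
        by (simp add: nn_integral_add nn_integral_cmult)
      finally show ?thesis using \<open>0 < c\<close> by (simp add: ennreal_mult'[symmetric])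
    qed
    show ?thesis
      by (rule tendsto_upperbound[OF tendsto_ennrealI[OF tendsto_norm[OF lim]]]) (auto intro!: always_eventually bnd)
  qed
  have "norm v \<le> P / c" if "0 < c" for c
  proof -
    obtain R0 where "box a b \<subseteq> ball 0 R0"
      using bounded_subset_ballD[OF bounded_box] by blast
    then have ev: "\<forall>\<^sub>F R in at_top. ennreal (norm v) \<le> ennreal c * N R + ennreal (P / c)"
      by (intro eventually_mono[OF eventually_ge_at_top[of R0]] v_le[OF that]) (auto simp: subset_eq)
    have "((\<lambda>R. ennreal c * N R + ennreal (P / c)) \<longlongrightarrow> ennreal c * 0 + ennreal (P / c)) at_top"
      by (intro tendsto_add ennreal_tendsto_cmult N_lim tendsto_const) auto
    then have "ennreal (norm v) \<le> ennreal c * 0 + ennreal (P / c)"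
      by (rule tendsto_lowerbound[OF _ ev]) auto
    then show ?thesis using that by (simp add: P_def integral_nonneg_AE ennreal_le_iff)
  qed
  then have "((\<lambda>c. P / c) \<longlongrightarrow> 0) at_top \<Longrightarrow> norm v \<le> 0"
    by (intro tendsto_lowerbound[where f="\<lambda>c. P / c" and F=at_top]) (auto intro: eventually_mono[OF eventually_gt_at_top[of 0]])
  moreover have "((\<lambda>c. P / c) \<longlongrightarrow> 0) at_top"
    by (intro tendsto_divide_0[OF tendsto_const] filterlim_at_top_imp_at_infinity filterlim_ident)
  ultimately show "v = 0" by simp
qed

section \<open>Inversion and the symbol of the fractional Laplacian\<close>

lemma fourier_integral_cnj:
  "fourier_integral (\<lambda>\<xi>. cnj (\<Phi> \<xi>)) x = cnj (fourier_integral \<Phi> (- x))"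
proof -
  have "(LINT \<xi>|lborel. exp (- \<i> * of_real (\<xi> \<bullet> x)) * cnj (\<Phi> \<xi>)) = (LINT \<xi>|lborel. cnj (exp (- \<i> * of_real (\<xi> \<bullet> (- x))) * \<Phi> \<xi>))"
    by (intro Bochner_Integration.integral_cong) (auto simp: exp_cnj)
  also have "\<dots> = cnj (LINT \<xi>|lborel. exp (- \<i> * of_real (\<xi> \<bullet> (- x))) * \<Phi> \<xi>)"
    by (rule Bochner_Integration.integral_cnj)
  finally show ?thesis by (simp add: fourier_integral_def)
qed

text \<open>The frequency profiles used to test a multiplier. For them Plancherel applies on both sides, and this
  gives inversion in \<open>L\<^sup>2\<close> without any decay estimate for the inverse transform.\<close>

locale continuous_compactly_supported =
  fixes \<Phi> :: "'a::euclidean_space \<Rightarrow> complex" and r :: real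
  assumes cont: "continuous_on UNIV \<Phi>" and supp: "\<And>\<xi>. r < norm \<xi> \<Longrightarrow> \<Phi> \<xi> = 0"
begin

lemma integrable: "integrable lborel \<Phi>"
proof -
  have "integrable lborel (\<lambda>x. indicator (cball 0 r) x *\<^sub>R \<Phi> x)"
    by (rule borel_integrable_compact) (use cont in \<open>auto intro: continuous_on_subset\<close>)
  also have "(\<lambda>x. indicator (cball 0 r) x *\<^sub>R \<Phi> x) = \<Phi>"
    using supp by (fastforce split: split_indicator)
  finally show ?thesis .
qed

lemma bounded: "\<exists>B. \<forall>\<xi>. norm (\<Phi> \<xi>) \<le> B"
proof -
  have "compact (\<Phi> ` cball 0 r)"
    by (rule compact_continuous_image) (use cont in \<open>auto intro: continuous_on_subset\<close>)
  then obtain B where B: "\<forall>\<xi>\<in>cball 0 r. norm (\<Phi> \<xi>) \<le> B"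
    by (auto dest!: compact_imp_bounded simp: bounded_iff)
  have "norm (\<Phi> \<xi>) \<le> max B 0" for \<xi>
    using B supp[of \<xi>] by (cases "r < norm \<xi>") (auto simp: le_max_iff_disj)
  then show ?thesis by blast
qed

lemma integrable_square: "integrable lborel (\<lambda>\<xi>. (cmod (\<Phi> \<xi>))\<^sup>2)"
proof -
  interpret sq: continuous_compactly_supported "\<lambda>\<xi>. of_real ((cmod (\<Phi> \<xi>))\<^sup>2)" r
    by standard (use cont supp in \<open>auto intro!: continuous_intros\<close>)
  show ?thesis using integrable_Re[OF sq.integrable] by simp
qed

lemma in_L2: "\<Phi> \<in> L2"
  using integrable_square borel_measurable_integrable[OF integrable] by (simp add: L2_def)

text \<open>Let \<open>g\<close> be the inverse transform of \<open>\<Phi>\<close> and \<open>gR R\<close> its truncation to a ball. Expanding the square, the cross term is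
  the energy of \<open>gR R\<close> by the exchange formula, and so is the energy of the transform of \<open>gR R\<close> by Plancherel. The squared error
  is therefore the energy of \<open>\<Phi>\<close> minus that of \<open>gR R\<close>, and the latter tends to the energy of \<open>g\<close>, which equals that
  of \<open>\<Phi>\<close>.\<close>

lemma has_fourier_L2_inverse: "has_fourier_L2 (\<lambda>x. fourier_integral \<Phi> (- x)) \<Phi>"
proof -
  obtain B where B: "\<And>\<xi>. norm (\<Phi> \<xi>) \<le> B" using bounded by blast
  have isC: "isCont \<Phi> \<xi>" for \<xi> using cont by (simp add: continuous_on_eq_continuous_at)
  have [measurable]: "\<Phi> \<in> borel_measurable borel"
    using integrable by (simp add: integrable_iff_bounded)
  define g where "g x = fourier_integral \<Phi> (- x)" for x
  have [measurable]: "g \<in> borel_measurable borel" unfolding g_def by measurable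
  note P = integrable_norm_fourier_integral_square[OF integrable B AE_I2[OF isC]]
    plancherel_integral[OF integrable B AE_I2[OF isC]]
  have reflect: "integrable lborel (\<lambda>x. f (- x)) \<longleftrightarrow> integrable lborel f" "(LINT x|lborel. f (- x)) = (LINT x|lborel. f x)"
    if [measurable]: "f \<in> borel_measurable borel" for f :: "'a \<Rightarrow> complex"
    using integrable_lborel_affine_iff[of f "-1" 0] integral_lborel_affine[of f "-1" 0] by auto
  define q where "q \<xi> = complex_of_real ((cmod (fourier_integral \<Phi> \<xi>))\<^sup>2)" for \<xi>
  have [measurable]: "q \<in> borel_measurable borel" unfolding q_def by measurable
  have q: "integrable lborel q" "(LINT x|lborel. q x) = of_real (LINT \<xi>|lborel. (cmod (\<Phi> \<xi>))\<^sup>2)"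
    unfolding q_def using P by (auto simp del: of_real_power)
  have gq: "q (- x) = complex_of_real ((cmod (g x))\<^sup>2)" for x by (simp add: q_def g_def)
  have g2: "integrable lborel (\<lambda>x. (cmod (g x))\<^sup>2)"
    using integrable_Re[of lborel "\<lambda>x. q (- x)"] reflect(1)[of q] q(1) by (simp add: gq)
  have g2_eq: "(LINT x|lborel. (cmod (g x))\<^sup>2) = (LINT \<xi>|lborel. (cmod (\<Phi> \<xi>))\<^sup>2)"
  proof -
    have "complex_of_real (LINT x|lborel. (cmod (g x))\<^sup>2) = (LINT x|lborel. q (- x))"
      unfolding gq integral_complex_of_real ..
    then show ?thesis using reflect(2)[of q] q(2) by simp
  qed
  have gL2: "g \<in> L2" using g2 by (simp add: L2_def)
  define C where "C = (2 * pi) powr (- real DIM('a) / 2) * (LINT x|lborel. norm (\<Phi> x))"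
  have gB: "norm (g x) \<le> C" for x
    unfolding g_def C_def by (rule norm_fourier_integral_le[OF integrable])
  have gC: "isCont g x" for x
  proof -
    have "continuous_on UNIV g"
      unfolding g_def
      by (rule continuous_on_compose2[OF continuous_fourier_integral[OF integrable]]) (auto intro: continuous_intros)
    then show ?thesis by (simp add: continuous_on_eq_continuous_at)
  qed
  define gR where "gR R x = indicator (ball 0 R) x * g x" for R x
  have [measurable]: "gR R \<in> borel_measurable borel" for R unfolding gR_def by measurable
  have norm_gR: "(cmod (gR R x))\<^sup>2 = indicator (ball 0 R) x * (cmod (g x))\<^sup>2" for R x
    by (auto simp: gR_def split: split_indicator)
  have gR: "integrable lborel (gR R)" for R
    unfolding gR_def by (rule integrable_L2_on_bounded[OF gL2]) auto
  have gR2: "integrable lborel (\<lambda>x. (cmod (gR R x))\<^sup>2)" for R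
    using g2 by (rule Bochner_Integration.integrable_bound) (auto simp: norm_gR split: split_indicator)
  have gRB: "norm (gR R x) \<le> C" for R x
    using gB[of x] order_trans[OF norm_ge_zero gB[of x]] by (auto simp: gR_def split: split_indicator)
  have gRC: "AE x in lborel. isCont (gR R) x" for R
    unfolding gR_def[abs_def] by (rule AE_isCont_indicator_times) (auto intro: gC simp: negligible_convex_frontier)
  note PR = integrable_norm_fourier_integral_square[OF gR gRB gRC]
    plancherel_integral[OF gR gRB gRC]
  have err: "(\<integral>\<^sup>+ \<xi>. ennreal ((cmod (\<Phi> \<xi> - fourier_integral (gR R) \<xi>))\<^sup>2) \<partial>lborel)
      = ennreal ((LINT \<xi>|lborel. (cmod (\<Phi> \<xi>))\<^sup>2) - (LINT x|lborel. (cmod (gR R x))\<^sup>2))" for R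
  proof -
    define h where "h \<xi> = fourier_integral (gR R) \<xi> * cnj (\<Phi> \<xi>)" for \<xi>
    define D where "D = (2 * pi) powr (- real DIM('a) / 2) * (LINT x|lborel. norm (gR R x))"
    have D: "norm (fourier_integral (gR R) \<xi>) \<le> D" for \<xi>
      unfolding D_def by (rule norm_fourier_integral_le[OF gR])
    have "integrable lborel (\<lambda>\<xi>. D * norm (\<Phi> \<xi>))"
      using integrable by auto
    then have hI: "integrable lborel h"
    proof (rule Bochner_Integration.integrable_bound)
      show "AE x in lborel. norm (h x) \<le> norm (D * norm (\<Phi> x))"
        by (intro AE_I2) (simp add: h_def norm_mult abs_mult mult_right_mono order_trans[OF D abs_ge_self])
      show "h \<in> borel_measurable lborel" unfolding h_def by measurable
    qed
    have "(LINT \<xi>|lborel. h \<xi>) = (LINT x|lborel. gR R x * fourier_integral (\<lambda>\<xi>. cnj (\<Phi> \<xi>)) x)"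
      unfolding h_def by (rule fourier_integral_exchange[OF gR]) (use integrable in auto)
    also have "\<dots> = (LINT x|lborel. complex_of_real ((cmod (gR R x))\<^sup>2))"
      unfolding fourier_integral_cnj
      by (intro Bochner_Integration.integral_cong)
        (auto simp: gR_def g_def complex_norm_square simp del: of_real_power split: split_indicator)
    also have "\<dots> = of_real (LINT x|lborel. (cmod (gR R x))\<^sup>2)"
      by (rule integral_complex_of_real)
    finally have hE: "(LINT \<xi>|lborel. Re (h \<xi>)) = (LINT x|lborel. (cmod (gR R x))\<^sup>2)"
      using integral_Re[OF hI] by simp
    have pt: "(cmod (\<Phi> \<xi> - fourier_integral (gR R) \<xi>))\<^sup>2
        = ((cmod (\<Phi> \<xi>))\<^sup>2 + (cmod (fourier_integral (gR R) \<xi>))\<^sup>2) - 2 * Re (h \<xi>)" for \<xi>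
      unfolding h_def cmod_power2 by (simp add: power2_eq_square algebra_simps)
    have I: "integrable lborel (\<lambda>\<xi>. (cmod (\<Phi> \<xi> - fourier_integral (gR R) \<xi>))\<^sup>2)"
      unfolding pt using integrable_square PR(1) hI by auto
    have "(\<integral>\<^sup>+ \<xi>. ennreal ((cmod (\<Phi> \<xi> - fourier_integral (gR R) \<xi>))\<^sup>2) \<partial>lborel)
        = ennreal (LINT \<xi>|lborel. (cmod (\<Phi> \<xi> - fourier_integral (gR R) \<xi>))\<^sup>2)"
      by (rule nn_integral_eq_integral[OF I]) auto
    also have "(LINT \<xi>|lborel. (cmod (\<Phi> \<xi> - fourier_integral (gR R) \<xi>))\<^sup>2)
       = (LINT \<xi>|lborel. (cmod (\<Phi> \<xi>))\<^sup>2) + (LINT \<xi>|lborel. (cmod (fourier_integral (gR R) \<xi>))\<^sup>2) - 2 * (LINT \<xi>|lborel. Re (h \<xi>))"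
      unfolding pt using integrable_square PR(1) hI
      by (subst Bochner_Integration.integral_diff) auto
    finally show ?thesis by (simp add: PR(2) hE)
  qed
  have "((\<lambda>R. LINT x|lborel. (cmod (gR R x))\<^sup>2) \<longlongrightarrow> (LINT x|lborel. (cmod (g x))\<^sup>2)) at_top"
  proof (rule integral_dominated_convergence_at_top[where w="\<lambda>x. (cmod (g x))\<^sup>2"])
    have "\<forall>\<^sub>F R in at_top. (cmod (gR R x))\<^sup>2 = (cmod (g x))\<^sup>2" for x
      using eventually_gt_at_top[of "norm x"] by eventually_elim (simp add: gR_def)
    then show "AE x in lborel. ((\<lambda>R. (cmod (gR R x))\<^sup>2) \<longlongrightarrow> (cmod (g x))\<^sup>2) at_top"
      by (intro AE_I2 tendsto_eventually)
    show "\<forall>\<^sub>F R in at_top. AE x in lborel. norm ((cmod (gR R x))\<^sup>2) \<le> (cmod (g x))\<^sup>2"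
      by (auto simp: norm_gR split: split_indicator intro!: always_eventually)
  qed (use g2 in auto)
  then have "((\<lambda>R. (LINT \<xi>|lborel. (cmod (\<Phi> \<xi>))\<^sup>2) - (LINT x|lborel. (cmod (gR R x))\<^sup>2))
      \<longlongrightarrow> (LINT \<xi>|lborel. (cmod (\<Phi> \<xi>))\<^sup>2) - (LINT x|lborel. (cmod (g x))\<^sup>2)) at_top"
    by (intro tendsto_intros)
  then have "((\<lambda>R. (LINT \<xi>|lborel. (cmod (\<Phi> \<xi>))\<^sup>2) - (LINT x|lborel. (cmod (gR R x))\<^sup>2)) \<longlongrightarrow> 0) at_top"
    by (simp add: g2_eq)
  from tendsto_ennrealI[OF this]
  have "((\<lambda>R. \<integral>\<^sup>+ \<xi>. ennreal ((cmod (\<Phi> \<xi> - fourier_integral (gR R) \<xi>))\<^sup>2) \<partial>lborel) \<longlongrightarrow> 0) at_top"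
    unfolding err by simp
  then show ?thesis
    using gL2 in_L2 unfolding has_fourier_L2_def gR_def[abs_def] g_def[abs_def] by simp
qed

end

text \<open>The functional calculus only speaks of some multiplier that represents the operator, so its symbol has to be
  recovered. On each ball \<open>norm \<xi> < N\<close> it is read off from one function in the domain whose transform is a cone
  that is positive exactly there.\<close>

lemma frac_laplacian_symbol_unique:
  fixes m :: "'a::euclidean_space \<Rightarrow> real"
  assumes H: "frac_laplacian s = fourier_multiplier (\<lambda>\<xi>. of_real (m \<xi>))" and s: "0 < s"
  shows "AE \<xi> in lborel. m \<xi> = norm \<xi> powr s"
proof -
  have on_ball: "AE \<xi> in lborel. norm \<xi> < real N \<longrightarrow> m \<xi> = norm \<xi> powr s" for N
  proof -
    define F where "F \<xi> = complex_of_real (max 0 (real N - norm \<xi>))" for \<xi> :: 'a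
    interpret F: continuous_compactly_supported F "real N"
      by standard (auto simp: F_def intro!: continuous_intros)
    interpret G: continuous_compactly_supported "\<lambda>\<xi>. of_real (norm \<xi> powr s) * F \<xi>" "real N"
    proof standard
      have "continuous_on UNIV (\<lambda>\<xi>::'a. norm \<xi> powr s)"
        using s by (intro continuous_on_powr' continuous_intros) auto
      then show "continuous_on UNIV (\<lambda>\<xi>. of_real (norm \<xi> powr s) * F \<xi>)"
        by (intro continuous_on_mult continuous_on_of_real F.cont)
    qed (simp add: F.supp)
    interpret S: continuous_compactly_supported "\<lambda>\<xi>. of_real ((1 + (norm \<xi>)\<^sup>2) powr (s / 2)) * F \<xi>" "real N"
    proof standard
      have "1 + (norm \<xi>)\<^sup>2 \<noteq> 0" for \<xi> :: 'a by (smt (verit) zero_le_power2)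
      then show "continuous_on UNIV (\<lambda>\<xi>. of_real ((1 + (norm \<xi>)\<^sup>2) powr (s / 2)) * F \<xi>)"
        by (intro continuous_intros F.cont) auto
    qed (simp add: F.supp)
    define f g where "f x = fourier_integral F (- x)"
      and "g x = fourier_integral (\<lambda>\<xi>. of_real (norm \<xi> powr s) * F \<xi>) (- x)" for x :: 'a
    have f: "has_fourier_L2 f F" and g: "has_fourier_L2 g (\<lambda>\<xi>. of_real (norm \<xi> powr s) * F \<xi>)"
      using F.has_fourier_L2_inverse G.has_fourier_L2_inverse by (simp_all add: f_def[abs_def] g_def[abs_def])
    have "f \<in> sobolev s"
      using f S.in_L2 unfolding sobolev_def has_fourier_L2_def by blast
    moreover have "fourier_multiplier (\<lambda>\<xi>. of_real (norm \<xi> powr s)) f g"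
      unfolding fourier_multiplier_def using f g by (intro exI conjI) auto
    ultimately have "frac_laplacian s f g" by (simp add: frac_laplacian_def)
    then obtain F' G' where F': "has_fourier_L2 f F'" and G': "has_fourier_L2 g G'"
      and eq: "AE \<xi> in lborel. G' \<xi> = of_real (m \<xi>) * F' \<xi>"
      unfolding H fourier_multiplier_def by blast
    show ?thesis
      using fourier_L2_unique[OF f F'] fourier_L2_unique[OF g G'] eq
    proof eventually_elim
      case (elim \<xi>)
      then have "of_real (norm \<xi> powr s) * F \<xi> = of_real (m \<xi>) * F \<xi>" by simp
      then show ?case by (auto simp: F_def)
    qed
  qed
  have "AE \<xi> in lborel. \<forall>N. norm \<xi> < real N \<longrightarrow> m \<xi> = norm \<xi> powr s"
    unfolding AE_all_countable by (intro allI on_ball)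
  then show ?thesis
    by eventually_elim (use reals_Archimedean2 in blast)
qed

text \<open>The multiplier and the transform of the initial datum may a priori be chosen differently for each time;
  uniqueness of both makes one \<open>U0\<close> serve for all times.\<close>

lemma cauchy_solution_fourier:
  fixes u :: "real \<Rightarrow> 'a::euclidean_space \<Rightarrow> complex"
  assumes u: "cauchy_solution (frac_laplacian s) u0 u" and s: "0 < s"
  obtains U0 U where "\<And>t. has_fourier_L2 (u t) (U t)"
    "\<And>t. AE \<xi> in lborel. U t \<xi> = exp (- \<i> * of_real (t * norm \<xi> powr s)) * U0 \<xi>"
proof -
  have ex: "\<exists>F G. has_fourier_L2 u0 F \<and> has_fourier_L2 (u t) G \<and>
      (AE \<xi> in lborel. G \<xi> = exp (- \<i> * of_real (t * norm \<xi> powr s)) * F \<xi>)" for t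
  proof -
    have "functional_calculus (\<lambda>l. exp (- \<i> * of_real t * of_real l)) (frac_laplacian s) u0 (u t)"
      using u by (simp add: cauchy_solution_def propagator_def)
    then obtain m where H: "(frac_laplacian s :: 'a L2_operator) = fourier_multiplier (\<lambda>\<xi>. of_real (m \<xi>))"
      and M: "fourier_multiplier (\<lambda>\<xi>. exp (- \<i> * of_real t * of_real (m \<xi>))) u0 (u t)"
      unfolding functional_calculus_def by (elim exE conjE)
    obtain F G where F: "has_fourier_L2 u0 F" and G: "has_fourier_L2 (u t) G"
      and FG: "AE \<xi> in lborel. G \<xi> = exp (- \<i> * of_real t * of_real (m \<xi>)) * F \<xi>"
      using M unfolding fourier_multiplier_def by (elim exE conjE)
    from FG frac_laplacian_symbol_unique[OF H s]
    have "AE \<xi> in lborel. G \<xi> = exp (- \<i> * of_real (t * norm \<xi> powr s)) * F \<xi>"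
      by eventually_elim (simp add: mult.assoc)
    with F G show ?thesis by blast
  qed
  then obtain F G where FG: "\<And>t. has_fourier_L2 u0 (F t)" "\<And>t. has_fourier_L2 (u t) (G t)"
    "\<And>t. AE \<xi> in lborel. G t \<xi> = exp (- \<i> * of_real (t * norm \<xi> powr s)) * F t \<xi>" by metis
  have "AE \<xi> in lborel. G t \<xi> = exp (- \<i> * of_real (t * norm \<xi> powr s)) * F 0 \<xi>" for t
    using FG(3)[of t] fourier_L2_unique[OF FG(1)[of t] FG(1)[of 0]] by eventually_elim simp
  with FG(2) show ?thesis by (rule that)
qed

section \<open>Analytic continuation of the transform along complex lines\<close>

text \<open>The Fourier-Laplace transform on the complex line \<open>z \<omega>\<close>, without the normalizing constant.\<close>

definition fourier_laplace_line :: "('a::euclidean_space \<Rightarrow> complex) \<Rightarrow> 'a \<Rightarrow> complex \<Rightarrow> complex" where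
  "fourier_laplace_line f \<omega> z = (LINT x|lborel. exp (- \<i> * z * of_real (x \<bullet> \<omega>)) * f x)"

lemma fourier_integral_scaleR:
  "fourier_integral f (l *\<^sub>R \<omega>) = of_real ((2 * pi) powr (- real DIM('a) / 2)) * fourier_laplace_line f \<omega> (of_real l)"
  for f :: "'a::euclidean_space \<Rightarrow> complex"
  by (simp add: fourier_integral_def fourier_laplace_line_def mult.assoc)

context
  fixes f :: "'a::euclidean_space \<Rightarrow> complex" and r :: real and \<omega> :: 'a
  assumes f: "integrable lborel f" and supp: "\<And>x. x \<notin> ball 0 r \<Longrightarrow> f x = 0" and \<omega>: "norm \<omega> = 1"
begin

lemma abs_inner_le_radius: "x \<in> ball 0 r \<Longrightarrow> \<bar>x \<bullet> \<omega>\<bar> \<le> r"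
  using Cauchy_Schwarz_ineq2[of x \<omega>] \<omega> by simp

lemma norm_fourier_laplace_line_le:
  "norm (fourier_laplace_line f \<omega> z) \<le> (LINT x|lborel. norm (f x)) * exp (r * \<bar>Im z\<bar>)"
proof -
  have [measurable]: "f \<in> borel_measurable borel" using f by (simp add: integrable_iff_bounded)
  have bnd: "norm (exp (- \<i> * z * of_real (x \<bullet> \<omega>)) * f x) \<le> norm (f x) * exp (r * \<bar>Im z\<bar>)" for x
  proof (cases "x \<in> ball 0 r")
    case True
    have "Im z * (x \<bullet> \<omega>) \<le> \<bar>Im z\<bar> * \<bar>x \<bullet> \<omega>\<bar>" by (metis abs_ge_self abs_mult)
    also have "\<dots> \<le> r * \<bar>Im z\<bar>"
      using mult_left_mono[OF abs_inner_le_radius[OF True], of "\<bar>Im z\<bar>"] by (simp add: mult.commute)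
    finally show ?thesis by (simp add: norm_mult mult.commute[of _ "norm (f x)"] mult_left_mono)
  qed (simp add: supp)
  have I: "integrable lborel (\<lambda>x. norm (f x) * exp (r * \<bar>Im z\<bar>))"
    using f by auto
  have "norm (fourier_laplace_line f \<omega> z) \<le> (LINT x|lborel. norm (f x) * exp (r * \<bar>Im z\<bar>))"
    unfolding fourier_laplace_line_def
  proof (rule Bochner_Integration.integral_norm_bound_integral[OF _ I bnd])
    show "integrable lborel (\<lambda>x. exp (- \<i> * z * of_real (x \<bullet> \<omega>)) * f x)"
    proof (rule Bochner_Integration.integrable_bound[OF I])
      show "AE x in lborel. norm (exp (- \<i> * z * of_real (x \<bullet> \<omega>)) * f x) \<le> norm (norm (f x) * exp (r * \<bar>Im z\<bar>))"
        unfolding real_norm_def by (intro AE_I2 order_trans[OF bnd abs_ge_self])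
    qed measurable
  qed
  then show ?thesis by simp
qed

text \<open>Expanding the exponential and integrating term by term gives an everywhere convergent power series, because
  the support is bounded.\<close>

lemma fourier_laplace_line_holomorphic: "fourier_laplace_line f \<omega> holomorphic_on UNIV"
proof -
  have [measurable]: "f \<in> borel_measurable borel" using f by (simp add: integrable_iff_bounded)
  define c where "c n = (LINT x|lborel. (- \<i> * of_real (x \<bullet> \<omega>)) ^ n /\<^sub>R fact n * f x)" for n
  have sums: "(\<lambda>n. c n * z ^ n) sums fourier_laplace_line f \<omega> z" for z
  proof -
    define T where "T n x = (- \<i> * z * of_real (x \<bullet> \<omega>)) ^ n /\<^sub>R fact n * f x" for n x
    define q where "q n = (r * norm z) ^ n /\<^sub>R fact n" for n
    have q: "summable q" unfolding q_def by (rule summable_exp_generic)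
    have bnd: "norm (T n x) \<le> q n * norm (f x)" for n x
    proof (cases "x \<in> ball 0 r")
      case True
      have "norm (- \<i> * z * of_real (x \<bullet> \<omega>)) \<le> r * norm z"
        using mult_left_mono[OF abs_inner_le_radius[OF True], of "norm z"] by (simp add: norm_mult mult.commute)
      then have "norm (- \<i> * z * of_real (x \<bullet> \<omega>)) ^ n \<le> (r * norm z) ^ n"
        by (intro power_mono) auto
      then show ?thesis
        unfolding T_def q_def by (simp add: norm_mult norm_power divide_right_mono mult_right_mono divide_inverse)
    qed (simp add: T_def supp)
    have qf: "integrable lborel (\<lambda>x. q n * norm (f x))" for n using f by auto
    have T_meas: "T n \<in> borel_measurable lborel" for n unfolding T_def by measurable
    have T: "integrable lborel (T n)" for n
      using qf[of n] by (rule Bochner_Integration.integrable_bound)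
        (use T_meas in \<open>auto intro!: AE_I2 order_trans[OF bnd abs_ge_self]\<close>)
    have "(\<lambda>n. LINT x|lborel. T n x) sums (LINT x|lborel. (\<Sum>n. T n x))"
    proof (rule sums_integral[OF T])
      have "summable (\<lambda>n. norm (T n x))" for x
        by (rule summable_comparison_test'[OF summable_mult2[OF q, of "norm (f x)"]]) (use bnd in auto)
      then show "AE x in lborel. summable (\<lambda>n. norm (T n x))" by simp
      have "(LINT x|lborel. norm (T n x)) \<le> q n * (LINT x|lborel. norm (f x))" for n
        using integral_mono[OF integrable_norm[OF T] qf bnd, of n] by simp
      then show "summable (\<lambda>n. LINT x|lborel. norm (T n x))"
        by (intro summable_comparison_test'[OF summable_mult2[OF q, of "LINT x|lborel. norm (f x)"]]) auto
    qed
    moreover have "(LINT x|lborel. T n x) = c n * z ^ n" for n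
    proof -
      have "T n x = (- \<i> * of_real (x \<bullet> \<omega>)) ^ n /\<^sub>R fact n * f x * z ^ n" for x
      proof -
        have "- \<i> * z * of_real (x \<bullet> \<omega>) = (- \<i> * of_real (x \<bullet> \<omega>)) * z" by simp
        then show ?thesis unfolding T_def by (simp only: power_mult_distrib) simp
      qed
      then show ?thesis by (simp add: c_def)
    qed
    moreover have "(\<Sum>n. T n x) = exp (- \<i> * z * of_real (x \<bullet> \<omega>)) * f x" for x
      unfolding T_def exp_def by (rule suminf_mult2[symmetric]) (rule summable_exp_generic)
    ultimately show ?thesis by (simp add: fourier_laplace_line_def)
  qed
  have "fourier_laplace_line f \<omega> holomorphic_on ball 0 R" for R
    by (rule power_series_holomorphic[where a=c]) (use sums in simp)
  then have "fourier_laplace_line f \<omega> field_differentiable at z" for z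
    by (rule holomorphic_on_imp_differentiable_at[where s="ball 0 (norm z + 1)"]) auto
  then show ?thesis
    by (simp add: holomorphic_on_def)
qed

end

lemma holomorphic_zero_if_zero_on_positive_reals:
  assumes "f holomorphic_on S" "open S" "connected S"
    and S: "\<And>l. 0 < l \<Longrightarrow> complex_of_real l \<in> S" and zero: "\<And>l. 0 < l \<Longrightarrow> f (complex_of_real l) = 0"
    and "z \<in> S"
  shows "f z = 0"
proof (rule analytic_continuation[where f=f and S=S and U="of_real ` {0<..}" and \<xi>=1])
  show "(1::complex) islimpt of_real ` {0<..}"
    unfolding islimpt_approachable
  proof (intro allI impI)
    fix e :: real assume "0 < e"
    then show "\<exists>x'\<in>complex_of_real ` {0<..}. x' \<noteq> 1 \<and> dist x' 1 < e"
      by (intro bexI[OF _ imageI[of "1 + e / 2"]]) (auto simp: dist_norm)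
  qed
qed (use assms S[of 1] in auto)

lemma entire_zero_if_zero_on_upper_halfplane:
  assumes "f holomorphic_on UNIV" "\<And>z. 0 < Im z \<Longrightarrow> f z = 0"
  shows "f z = 0"
proof (rule analytic_continuation_open[of "{z. 0 < Im z}" UNIV f "\<lambda>_. 0"])
  show "{z. 0 < Im z} \<noteq> {}" by (auto intro: exI[of _ \<i>])
qed (use assms in \<open>auto simp: open_halfspace_Im_gt\<close>)

text \<open>The identity \<open>G z = exp (- \<i> t z\<^sup>s) F z\<close> continues to the right half-plane. For \<open>s > 1\<close> the direction
  \<open>\<theta> = \<pi> / (2 s)\<close> lies strictly inside the first quadrant, and there \<open>z\<^sup>s = \<i> \<rho>\<^sup>s\<close>, so \<open>F\<close> is smaller than \<open>G\<close> by the factor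
  \<open>exp (- t \<rho>\<^sup>s)\<close>. Since \<open>G\<close> has exponential type, \<open>F\<close> decays superexponentially along that ray, while
  \<open>F z exp (\<i> a z)\<close> is bounded in the upper half-plane.\<close>

lemma superlinear_phase_forces_zero:
  fixes F G :: "complex \<Rightarrow> complex"
  assumes F: "F holomorphic_on UNIV" and G: "G holomorphic_on UNIV"
    and FA: "\<And>z. norm (F z) \<le> A * exp (a * \<bar>Im z\<bar>)" and GB: "\<And>z. norm (G z) \<le> B * exp (b * \<bar>Im z\<bar>)"
    and "0 \<le> a" "0 \<le> b" and s: "1 < s" and t: "0 < t"
    and FG: "\<And>l. 0 < l \<Longrightarrow> G (of_real l) = exp (- \<i> * of_real (t * l powr s)) * F (of_real l)"
  shows "F z = 0"
proof -
  define S where "S = {z. 0 < Re z}"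
  have S: "open S" "connected S" by (auto simp: S_def open_halfspace_Re_gt intro!: convex_connected convex_halfspace_Re_gt)
  have cont: "G z - exp (- \<i> * t * z powr s) * F z = 0" if "z \<in> S" for z
  proof (rule holomorphic_zero_if_zero_on_positive_reals[where S=S and f="\<lambda>z. G z - exp (- \<i> * t * z powr s) * F z"])
    show "(\<lambda>z. G z - exp (- \<i> * t * z powr s) * F z) holomorphic_on S"
      by (intro holomorphic_intros holomorphic_on_subset[OF F] holomorphic_on_subset[OF G])
        (auto simp: S_def complex_nonpos_Reals_iff)
    show "G (of_real l) - exp (- \<i> * t * complex_of_real l powr complex_of_real s) * F (of_real l) = 0" if "0 < l" for l
      using FG[OF that] that by (simp add: powr_of_real mult.assoc)
  qed (use S that in \<open>auto simp: S_def\<close>)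
  define \<theta> where "\<theta> = pi / (2 * s)"
  have \<theta>: "0 < \<theta>" "\<theta> < pi / 2" "s * \<theta> = pi / 2"
    using s pi_gt_zero by (auto simp: \<theta>_def field_simps)
  have "0 \<le> B" using GB[of 0] order_trans[OF norm_ge_zero] by fastforce
  have "0 \<le> A" using FA[of 0] order_trans[OF norm_ge_zero] by fastforce
  have F_ray: "norm (F (rcis \<rho> \<theta>)) \<le> B * exp (b * \<rho> - t * \<rho> powr s)" if "0 < \<rho>" for \<rho>
  proof -
    define z where "z = rcis \<rho> \<theta>"
    have z: "z = exp (Complex (ln \<rho>) \<theta>)" using that by (simp add: z_def exp_eq_polar rcis_def)
    have "Ln z = Complex (ln \<rho>) \<theta>"
      unfolding z using \<theta> by (intro Ln_exp) auto
    then have "of_real s * Ln z = Complex (s * ln \<rho>) (pi / 2)"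
      using \<theta>(3) by (simp add: complex_eq_iff)
    moreover have "z \<noteq> 0" using z by simp
    ultimately have "z powr s = exp (Complex (s * ln \<rho>) (pi / 2))"
      by (simp add: powr_def)
    also have "\<dots> = \<i> * of_real (\<rho> powr s)"
      using that by (simp add: exp_eq_polar powr_def)
    finally have "- \<i> * t * z powr s = of_real (t * \<rho> powr s)" by (simp add: complex_eq_iff)
    moreover have "0 < cos \<theta>" using \<theta> by (intro cos_gt_zero) auto
    then have "z \<in> S" using that by (simp add: S_def z_def)
    ultimately have "G z = exp (of_real (t * \<rho> powr s)) * F z" using cont[of z] by simp
    then have "norm (G z) = exp (t * \<rho> powr s) * norm (F z)" by (simp add: norm_mult)
    then have "norm (F z) = norm (G z) * exp (- (t * \<rho> powr s))" by (simp add: exp_minus field_simps)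
    also have "\<dots> \<le> B * exp (b * \<bar>Im z\<bar>) * exp (- (t * \<rho> powr s))"
      by (intro mult_right_mono GB) auto
    also have "\<dots> \<le> B * exp (b * \<rho>) * exp (- (t * \<rho> powr s))"
    proof -
      have "\<bar>Im z\<bar> \<le> \<rho>" using abs_Im_le_cmod[of z] that by (simp add: z_def)
      then show ?thesis using \<open>0 \<le> b\<close> \<open>0 \<le> B\<close> by (intro mult_right_mono mult_left_mono) (auto intro: mult_left_mono)
    qed
    also have "\<dots> = B * exp (b * \<rho> - t * \<rho> powr s)" by (simp add: exp_diff exp_minus divide_inverse)
    finally show ?thesis by (simp add: z_def)
  qed
  define h where "h z = F z * exp (\<i> * a * z)" for z
  have norm_h: "norm (h z) = norm (F z) * exp (- (a * Im z))" for z
    by (simp add: h_def norm_mult)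
  have "h z = 0" if "0 < Im z" for z
  proof (rule bounded_halfplane_superexponential_ray_zero[where h=h and M=A and \<theta>=\<theta>])
    show "h holomorphic_on UNIV" unfolding h_def by (intro holomorphic_intros F)
    show "norm (h z) \<le> A" if "0 \<le> Im z" for z
    proof -
      have "norm (h z) \<le> A * exp (a * \<bar>Im z\<bar>) * exp (- (a * Im z))"
        unfolding norm_h by (intro mult_right_mono FA) auto
      then show ?thesis using that by (simp add: mult.assoc flip: exp_add)
    qed
    show "\<exists>C. \<forall>\<rho>>0. norm (h (rcis \<rho> \<theta>)) \<le> C * exp (- (real N * \<rho>))" for N
    proof (intro exI allI impI)
      fix \<rho> :: real assume \<rho>: "0 < \<rho>"
      \<comment> \<open>Beyond \<open>\<rho>0\<close> the term \<open>t \<rho>\<^sup>s\<close> dominates \<open>(b + N) \<rho>\<close>.\<close>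
      define \<rho>0 where "\<rho>0 = ((b + real N) / t) powr (1 / (s - 1))"
      have le: "(b + N) * \<rho> - t * \<rho> powr s \<le> (b + N) * \<rho>0"
      proof (cases "\<rho> \<le> \<rho>0")
        case True
        then have "(b + N) * \<rho> \<le> (b + N) * \<rho>0" using \<open>0 \<le> b\<close> by (intro mult_left_mono) auto
        then show ?thesis using t by (smt (verit) mult_nonneg_nonneg powr_ge_zero)
      next
        case False
        then have "\<rho>0 powr (s - 1) \<le> \<rho> powr (s - 1)" using s by (intro powr_mono2) (auto simp: \<rho>0_def)
        moreover have "\<rho>0 powr (s - 1) = (b + N) / t"
          using s t \<open>0 \<le> b\<close> by (cases "b + N = 0") (auto simp: \<rho>0_def powr_powr)
        ultimately have "b + N \<le> t * \<rho> powr (s - 1)" using t by (simp add: field_simps)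
        then have "(b + N) * \<rho> \<le> t * \<rho> powr (s - 1) * \<rho>" using \<rho> by (intro mult_right_mono) auto
        also have "\<dots> = t * \<rho> powr s" using \<rho> by (simp add: powr_diff)
        finally show ?thesis using \<open>0 \<le> b\<close> by (smt (verit) \<rho>0_def mult_nonneg_nonneg of_nat_0_le_iff powr_ge_zero)
      qed
      have "0 \<le> a * Im (rcis \<rho> \<theta>)"
        using \<rho> \<theta> \<open>0 \<le> a\<close> by (simp add: sin_ge_zero)
      then have "norm (h (rcis \<rho> \<theta>)) \<le> norm (F (rcis \<rho> \<theta>)) * 1"
        unfolding norm_h by (intro mult_left_mono) auto
      also have "\<dots> \<le> B * exp (b * \<rho> - t * \<rho> powr s)" using F_ray[OF \<rho>] by simp
      also have "b * \<rho> - t * \<rho> powr s = ((b + N) * \<rho> - t * \<rho> powr s) - N * \<rho>" by (simp add: algebra_simps)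
      also have "B * exp (((b + N) * \<rho> - t * \<rho> powr s) - N * \<rho>) \<le> B * exp ((b + N) * \<rho>0 - N * \<rho>)"
        using le \<open>0 \<le> B\<close> by (intro mult_left_mono) auto
      also have "\<dots> = (B * exp ((b + N) * (((b + real N) / t) powr (1 / (s - 1))))) * exp (- (real N * \<rho>))"
        by (simp add: \<rho>0_def exp_diff exp_minus divide_inverse)
      finally show "norm (h (rcis \<rho> \<theta>)) \<le> (B * exp ((b + N) * (((b + real N) / t) powr (1 / (s - 1))))) * exp (- (real N * \<rho>))" .
    qed
  qed (use \<theta> that in auto)
  then have "F z = 0" if "0 < Im z" for z using that by (auto simp: h_def)
  then show ?thesis by (rule entire_zero_if_zero_on_upper_halfplane[OF F])
qed

text \<open>For \<open>s = 1\<close> no decay is available, but \<open>|l|\<close> has different analytic continuations from the two half-lines: \<open>F\<close> is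
  multiplied by both \<open>exp (- \<i> t z)\<close> and \<open>exp (\<i> t z)\<close> to give \<open>G\<close>, and these differ off the real axis.\<close>

lemma linear_phase_forces_zero:
  fixes F G :: "complex \<Rightarrow> complex"
  assumes F: "F holomorphic_on UNIV" and G: "G holomorphic_on UNIV" and t: "0 < t"
    and FG: "\<And>l. G (of_real l) = exp (- \<i> * of_real (t * \<bar>l\<bar>)) * F (of_real l)"
  shows "F z = 0"
proof (rule entire_zero_if_zero_on_upper_halfplane[OF F])
  fix z :: complex assume z: "0 < Im z"
  have pos: "G w - exp (- \<i> * t * w) * F w = 0" for w
    by (rule holomorphic_zero_if_zero_on_positive_reals[where S=UNIV and f="\<lambda>w. G w - exp (- \<i> * t * w) * F w"])
      (auto intro!: holomorphic_intros F G simp: FG mult.assoc)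
  have neg: "G (- w) - exp (- \<i> * t * w) * F (- w) = 0" for w
  proof (rule holomorphic_zero_if_zero_on_positive_reals[where S=UNIV and f="\<lambda>w. G (- w) - exp (- \<i> * t * w) * F (- w)"])
    show "(\<lambda>w. G (- w) - exp (- \<i> * t * w) * F (- w)) holomorphic_on UNIV"
      by (intro holomorphic_intros holomorphic_on_compose_gen[OF _ F, unfolded o_def] holomorphic_on_compose_gen[OF _ G, unfolded o_def]) auto
    show "G (- of_real l) - exp (- \<i> * t * of_real l) * F (- of_real l) = 0" if "0 < l" for l
      using FG[of "- l"] that by (simp add: mult.assoc)
  qed auto
  have "exp (- \<i> * t * z) * F z = exp (\<i> * t * z) * F z"
    using pos[of z] neg[of "- z"] by simp
  then have "norm (exp (- \<i> * t * z)) * norm (F z) = norm (exp (\<i> * t * z)) * norm (F z)"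
    by (metis norm_mult)
  then have "exp (t * Im z) = exp (- (t * Im z)) \<or> F z = 0" by auto
  moreover have "0 < t * Im z" using t z by simp
  ultimately show "F z = 0" by auto
qed

text \<open>Every frequency lies on a real line through the origin; on that line the one-variable results apply, with
  exponential type at most the radius of the supporting ball.\<close>

lemma compact_support_phase_multiplier_zero:
  fixes f g :: "'a::euclidean_space \<Rightarrow> complex"
  assumes f: "integrable lborel f" "\<And>x. x \<notin> ball 0 r \<Longrightarrow> f x = 0"
    and g: "integrable lborel g" "\<And>x. x \<notin> ball 0 R \<Longrightarrow> g x = 0"
    and rR: "0 \<le> r" "0 \<le> R" and s: "1 \<le> s" and t: "0 < t"
    and fg: "\<And>\<xi>. fourier_integral g \<xi> = exp (- \<i> * of_real (t * norm \<xi> powr s)) * fourier_integral f \<xi>"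
  shows "fourier_integral f \<xi> = 0"
proof -
  define \<omega> where "\<omega> = (if \<xi> = 0 then SOME b. b \<in> Basis else \<xi> /\<^sub>R norm \<xi>)"
  have \<omega>: "norm \<omega> = 1" by (simp add: \<omega>_def SOME_Basis)
  have \<xi>: "\<xi> = norm \<xi> *\<^sub>R \<omega>" by (simp add: \<omega>_def)
  define F G where "F = fourier_laplace_line f \<omega>" and "G = fourier_laplace_line g \<omega>"
  note F = fourier_laplace_line_holomorphic[OF f \<omega>, folded F_def] norm_fourier_laplace_line_le[OF f \<omega>, folded F_def]
  note G = fourier_laplace_line_holomorphic[OF g \<omega>, folded G_def] norm_fourier_laplace_line_le[OF g \<omega>, folded G_def]
  have FG: "G (of_real l) = exp (- \<i> * of_real (t * \<bar>l\<bar> powr s)) * F (of_real l)" for l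
    using fg[of "l *\<^sub>R \<omega>"] \<omega> by (simp add: fourier_integral_scaleR F_def G_def)
  have "F z = 0" for z
  proof (cases "s = 1")
    case True
    have FG1: "G (of_real l) = exp (- \<i> * of_real (t * \<bar>l\<bar>)) * F (of_real l)" for l
      using FG[of l] True by simp
    show ?thesis
      by (rule linear_phase_forces_zero[OF F(1) G(1) t FG1])
  next
    case False
    show ?thesis
      by (rule superlinear_phase_forces_zero[OF F(1) G(1) F(2) G(2) rR])
        (use FG s t False in auto)
  qed
  then show ?thesis
    by (subst \<xi>) (simp only: fourier_integral_scaleR F_def mult_zero_right)
qed

lemma continuous_AE_eq_imp_eq:
  fixes p q :: "'a::euclidean_space \<Rightarrow> complex"
  assumes "continuous_on UNIV p" "continuous_on UNIV q" and AE: "AE x in lborel. p x = q x"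
  shows "p x = q x"
proof (rule ccontr)
  assume "p x \<noteq> q x"
  define D where "D = {x. p x \<noteq> q x}"
  have "open D" unfolding D_def using assms by (intro open_Collect_neq)
  moreover have "negligible D"
  proof -
    have "{x \<in> space lborel. \<not> (p x = q x)} \<in> null_sets lborel"
      using AE \<open>open D\<close> by (subst (asm) AE_iff_null) (auto simp: D_def)
    then show ?thesis
      by (auto simp: D_def negligible_iff_null_sets null_sets_completionI)
  qed
  ultimately show False
    using open_not_negligible \<open>p x \<noteq> q x\<close> by (auto simp: D_def)
qed

section \<open>Solutions of bounded support at two times\<close>

text \<open>Almost everywhere the transforms at the two times differ by a unimodular factor. For bounded supports both are
  continuous, so the relation holds at every frequency and can be restricted to lines. Once the transform vanishes
  at one time, it vanishes at all times.\<close>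

theorem bounded_support_at_two_times_imp_zero:
  fixes u :: "real \<Rightarrow> 'a::euclidean_space \<Rightarrow> complex"
  assumes s: "1 \<le> s" and u: "cauchy_solution (frac_laplacian s) u0 u" and "t1 < t2"
    and supp: "bounded (ess_supp (u t1))" "bounded (ess_supp (u t2))"
  shows "AE x in lborel. u t x = 0"
proof -
  have "0 < s" using s by simp
  with u obtain U0 U where U: "\<And>t. has_fourier_L2 (u t) (U t)"
    and U0: "\<And>t. AE \<xi> in lborel. U t \<xi> = exp (- \<i> * of_real (t * norm \<xi> powr s)) * U0 \<xi>"
    by (rule cauchy_solution_fourier) (rule that)
  obtain r where r: "0 < r" "ess_supp (u t1) \<subseteq> ball 0 r"
    using bounded_subset_ballD[OF supp(1)] by blast
  obtain R where R: "0 < R" "ess_supp (u t2) \<subseteq> ball 0 R"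
    using bounded_subset_ballD[OF supp(2)] by blast
  define f g where "f x = indicator (ball 0 r) x * u t1 x" and "g x = indicator (ball 0 R) x * u t2 x" for x
  have L2: "u t \<in> L2" for t using U by (simp add: has_fourier_L2_def)
  have f: "integrable lborel f" "\<And>x. x \<notin> ball 0 r \<Longrightarrow> f x = 0"
    and g: "integrable lborel g" "\<And>x. x \<notin> ball 0 R \<Longrightarrow> g x = 0"
    unfolding f_def g_def by (auto intro!: integrable_L2_on_bounded L2)
  have Uf: "AE \<xi> in lborel. U t1 \<xi> = fourier_integral f \<xi>"
    and Ug: "AE \<xi> in lborel. U t2 \<xi> = fourier_integral g \<xi>"
    unfolding f_def g_def using fourier_L2_eq_fourier_integral[OF U] r R by auto
  have fg: "fourier_integral g \<xi> = exp (- \<i> * of_real ((t2 - t1) * norm \<xi> powr s)) * fourier_integral f \<xi>" for \<xi>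
  proof (rule continuous_AE_eq_imp_eq[of "fourier_integral g"])
    show "continuous_on UNIV (fourier_integral g)" by (rule continuous_fourier_integral[OF g(1)])
    show "continuous_on UNIV (\<lambda>\<xi>. exp (- \<i> * of_real ((t2 - t1) * norm \<xi> powr s)) * fourier_integral f \<xi>)"
      using \<open>0 < s\<close> by (intro continuous_on_mult continuous_on_exp continuous_on_of_real continuous_on_const
          continuous_on_powr' continuous_on_norm continuous_on_id continuous_fourier_integral f(1)) auto
    show "AE \<xi> in lborel. fourier_integral g \<xi> = exp (- \<i> * of_real ((t2 - t1) * norm \<xi> powr s)) * fourier_integral f \<xi>"
      using Uf Ug U0[of t1] U0[of t2]
    proof eventually_elim
      case (elim \<xi>)
      have "exp (- \<i> * of_real (t2 * norm \<xi> powr s))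
          = exp (- \<i> * of_real ((t2 - t1) * norm \<xi> powr s)) * exp (- \<i> * of_real (t1 * norm \<xi> powr s))"
        by (simp add: algebra_simps flip: exp_add)
      then show ?case using elim by (simp only: mult.assoc)
    qed
  qed
  have f0: "fourier_integral f \<xi> = 0" for \<xi>
    by (rule compact_support_phase_multiplier_zero[OF f g _ _ s _ fg]) (use r R \<open>t1 < t2\<close> in auto)
  from Uf U0[of t1] have "AE \<xi> in lborel. U0 \<xi> = 0"
    by eventually_elim (simp add: f0)
  with U0[of t] have "AE \<xi> in lborel. U t \<xi> = 0" by eventually_elim simp
  then show ?thesis by (rule fourier_L2_injective[OF U])
qed

text \<open>With \<open>\<sigma> = T\<^sub>0 = 1\<close> the hypothesis places both supports inside balls, so they are bounded.\<close>

theorem corollary4p2: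
  fixes s :: real
  assumes "CARD('n::finite) \<ge> 3" and "s \<ge> 1"
  shows "\<exists>\<sigma>>0. \<exists>T0>0. \<forall>(u0 :: real^'n \<Rightarrow> complex) (u :: real \<Rightarrow> real^'n \<Rightarrow> complex).
    u0 \<in> L2 \<longrightarrow> cauchy_solution (frac_laplacian s) u0 u \<longrightarrow>
    (\<exists>r t1 t2. r > 0 \<and> 0 \<le> t1 \<and> t1 < t2 \<and> t2 - t1 > r powr s * T0 \<and>
        ess_supp (u t1) \<subseteq> ball 0 r \<and>
        ess_supp (u t2) \<subseteq> ball 0 (\<sigma> * (t2 - t1) / r powr (s - 1))) \<longrightarrow>
    (\<forall>t. AE x in lborel. u t x = 0)"
proof (intro exI[of _ "1::real"] conjI allI impI)
  fix u0 :: "real^'n \<Rightarrow> complex" and u :: "real \<Rightarrow> real^'n \<Rightarrow> complex" and t :: real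
  assume u: "cauchy_solution (frac_laplacian s) u0 u"
    and "\<exists>r t1 t2. r > 0 \<and> 0 \<le> t1 \<and> t1 < t2 \<and> t2 - t1 > r powr s * 1 \<and>
        ess_supp (u t1) \<subseteq> ball 0 r \<and> ess_supp (u t2) \<subseteq> ball 0 (1 * (t2 - t1) / r powr (s - 1))"
  then obtain r t1 t2 where "t1 < t2" "ess_supp (u t1) \<subseteq> ball 0 r"
      "ess_supp (u t2) \<subseteq> ball 0 (1 * (t2 - t1) / r powr (s - 1))"
    by blast
  then show "AE x in lborel. u t x = 0"
    by (intro bounded_support_at_two_times_imp_zero[OF \<open>s \<ge> 1\<close> u \<open>t1 < t2\<close>] bounded_subset[OF bounded_ball])
qed auto

end
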